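(* Let $X$ and $Y$ be Tychonoff spaces and suppose there is a linear continuous surjection from $C_p^*(X)$ onto $C_p^*(Y)$. If $X$ is $0$-dimensional (i.e. $\dim X=0$), then $Y$ is $0$-dimensional (i.e. $\dim Y=0$).
   Context: All spaces are (non-empty) Tychonoff spaces. $C^*_p(X)$ is the set of all continuous bounded real-valued functions on $X$ endowed with the topology of pointwise convergence. $\dim$ is the covering dimension defined by finite functionally open covers: $\dim X\le n$ if every finite cover of $X$ by functionally open sets (cozero sets) has a finite functionally open refinement such that each point lies in at most $n+1$ of its members. A space is $0$-dimensional if its covering dimension $\dim$ is $0$. *)

theory Defs
  imports "HOL-Analysis.Analysis" "HOL-Library.Extended_Nat"
begin

definition tychonoff_space :: "'a topology \<Rightarrow> bool" where
  "tychonoff_space X \<longleftrightarrow> completely_regular_space X \<and> Hausdorff_space X"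

subsection \<open>Spaces of bounded continuous functions with the pointwise topology\<close>

text \<open>Functions on a space \<open>X\<close> are represented by functions that are \<^const>\<open>extensional\<close> on
  \<open>topspace X\<close>, as in \<^const>\<open>product_topology\<close>.\<close>

definition bounded_continuous_functions :: "'a topology \<Rightarrow> ('a \<Rightarrow> real) set" where
  "bounded_continuous_functions X =
     {f \<in> extensional (topspace X). continuous_map X euclideanreal f \<and> bounded (f ` topspace X)}"

definition Cp_star :: "'a topology \<Rightarrow> ('a \<Rightarrow> real) topology" where
  "Cp_star X = subtopology (product_topology (\<lambda>_. euclideanreal) (topspace X))
                 (bounded_continuous_functions X)"

text \<open>The values of \<open>T\<close> outside \<^term>\<open>bounded_continuous_functions X\<close> are irrelevant.\<close>

definition linear_Cp_star ::
  "'a topology \<Rightarrow> 'b topology \<Rightarrow> (('a \<Rightarrow> real) \<Rightarrow> ('b \<Rightarrow> real)) \<Rightarrow> bool" where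
  "linear_Cp_star X Y T \<longleftrightarrow>
     (\<forall>f\<in>bounded_continuous_functions X. \<forall>g\<in>bounded_continuous_functions X. \<forall>y\<in>topspace Y.
        T (\<lambda>x\<in>topspace X. f x + g x) y = T f y + T g y) \<and>
     (\<forall>c::real. \<forall>f\<in>bounded_continuous_functions X. \<forall>y\<in>topspace Y.
        T (\<lambda>x\<in>topspace X. c * f x) y = c * T f y)"

lemma topspace_Cp_star: "topspace (Cp_star X) = bounded_continuous_functions X"
proof -
  have "bounded_continuous_functions X \<subseteq> (\<Pi>\<^sub>E x\<in>topspace X. UNIV)"
    unfolding bounded_continuous_functions_def PiE_def by blast
  then show ?thesis
    by (simp add: Cp_star_def Int_absorb1)
qed

lemma bounded_continuous_functions_add:
  assumes "f \<in> bounded_continuous_functions X" "g \<in> bounded_continuous_functions X"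
  shows "(\<lambda>x\<in>topspace X. f x + g x) \<in> bounded_continuous_functions X"
proof -
  have "continuous_map X euclideanreal (\<lambda>x\<in>topspace X. f x + g x)"
    by (rule continuous_map_eq[OF continuous_map_add[of X f g]])
       (use assms in \<open>simp_all add: bounded_continuous_functions_def\<close>)
  moreover have "bounded ((\<lambda>x. f x + g x) ` topspace X)"
    by (rule bounded_plus_comp) (use assms in \<open>simp_all add: bounded_continuous_functions_def\<close>)
  ultimately show ?thesis
    by (simp add: bounded_continuous_functions_def)
qed

lemma bounded_continuous_functions_cmult:
  assumes "f \<in> bounded_continuous_functions X"
  shows "(\<lambda>x\<in>topspace X. c * f x) \<in> bounded_continuous_functions X"
proof -
  have "continuous_map X euclideanreal (\<lambda>x\<in>topspace X. c * f x)"
    by (rule continuous_map_eq[OF continuous_map_real_mult_left[of X f c]])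
       (use assms in \<open>simp_all add: bounded_continuous_functions_def\<close>)
  moreover have "bounded ((\<lambda>x. c * f x) ` topspace X)"
    using assms bounded_scaling[of "f ` topspace X" c]
    by (simp add: bounded_continuous_functions_def image_image)
  ultimately show ?thesis
    by (simp add: bounded_continuous_functions_def)
qed

subsection \<open>Covering dimension\<close>

definition functionally_open_in :: "'a topology \<Rightarrow> 'a set \<Rightarrow> bool" where
  "functionally_open_in X U \<longleftrightarrow>
     (\<exists>f. continuous_map X euclideanreal f \<and> U = {x \<in> topspace X. f x \<noteq> 0})"

definition finite_functionally_open_cover :: "'a topology \<Rightarrow> 'a set set \<Rightarrow> bool" where
  "finite_functionally_open_cover X \<U> \<longleftrightarrow>
     finite \<U> \<and> (\<forall>U\<in>\<U>. functionally_open_in X U) \<and> \<Union>\<U> = topspace X"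

definition covering_dim_le :: "'a topology \<Rightarrow> nat \<Rightarrow> bool" where
  "covering_dim_le X n \<longleftrightarrow>
     (\<forall>\<U>. finite_functionally_open_cover X \<U> \<longrightarrow>
        (\<exists>\<V>. finite_functionally_open_cover X \<V> \<and>
             (\<forall>V\<in>\<V>. \<exists>U\<in>\<U>. V \<subseteq> U) \<and>
             (\<forall>x\<in>topspace X. card {V \<in> \<V>. x \<in> V} \<le> n + 1)))"

text \<open>The value is \<open>\<infinity>\<close> if no bound exists. Only meaningful for non-empty spaces: the empty space
  gets dimension \<open>0\<close> here instead of the conventional \<open>-1\<close>.\<close>

definition covering_dim :: "'a topology \<Rightarrow> enat" where
  "covering_dim X = Inf {enat n | n. covering_dim_le X n}"

lemma covering_dim_le_iff: "covering_dim X \<le> enat n \<longleftrightarrow> covering_dim_le X n"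
proof
  assume "covering_dim_le X n"
  then show "covering_dim X \<le> enat n"
    unfolding covering_dim_def by (intro Inf_lower) auto
next
  let ?A = "{enat n | n. covering_dim_le X n}"
  assume *: "covering_dim X \<le> enat n"
  have "?A \<noteq> {}"
  proof
    assume "?A = {}"
    then have "covering_dim X = \<infinity>"
      unfolding covering_dim_def by (simp only: Inf_enat_def simp_thms if_True)
    with * show False by simp
  qed
  then obtain k where "k \<in> ?A" by blast
  then have "(LEAST k. k \<in> ?A) \<in> ?A" by (rule LeastI)
  then have mem: "covering_dim X \<in> ?A"
    unfolding covering_dim_def Inf_enat_def using \<open>?A \<noteq> {}\<close> by (simp only: if_False)
  from mem obtain m where m: "covering_dim X = enat m" "covering_dim_le X m"
    by auto
  have "m \<le> n" using * m(1) by simp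
  show "covering_dim_le X n"
    unfolding covering_dim_le_def
  proof (intro allI impI)
    fix \<U>
    assume "finite_functionally_open_cover X \<U>"
    with m(2) obtain \<V> where \<V>: "finite_functionally_open_cover X \<V>" "\<forall>V\<in>\<V>. \<exists>U\<in>\<U>. V \<subseteq> U"
      and card: "\<And>x. x \<in> topspace X \<Longrightarrow> card {V \<in> \<V>. x \<in> V} \<le> m + 1"
      unfolding covering_dim_le_def by metis
    have "card {V \<in> \<V>. x \<in> V} \<le> n + 1" if "x \<in> topspace X" for x
      using card[OF that] \<open>m \<le> n\<close> by linarith
    with \<V> show "\<exists>\<V>. finite_functionally_open_cover X \<V> \<and> (\<forall>V\<in>\<V>. \<exists>U\<in>\<U>. V \<subseteq> U) \<and>
        (\<forall>x\<in>topspace X. card {V \<in> \<V>. x \<in> V} \<le> n + 1)"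
      by (intro exI[of _ \<V>] conjI ballI) simp_all
  qed
qed

end

theory Submission
  imports Defs
begin

text \<open>
  A continuous linear surjection \<open>T : C\<^sub>p\<^sup>*(X) \<rightarrow> C\<^sub>p\<^sup>*(Y)\<close> turns a point \<open>y\<close> of \<open>Y\<close> into a functional
  \<open>f \<mapsto> T f y\<close> that depends on finitely many values of \<open>f\<close> only. Restricted to indicators of clopen
  sets it is a finitely additive charge \<open>\<mu> y\<close> with finite support. The proof transfers zero-dimensionality
  along \<open>y \<mapsto> \<mu> y\<close>.

  Two facts about the sup norms are needed, both consequences of the Baire category theorem: \<open>T\<close> is
  bounded, and functions on \<open>Y\<close> of norm at most \<open>1\<close> can be approximated by images of functions of norm
  at most a fixed \<open>K\<close> (\<open>T_bounded\<close>, \<open>T_almost_open\<close>). Because \<open>dim X = 0\<close>, the latter may be taken to be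
  finite linear combinations of indicators of clopen sets, again with coefficients bounded by \<open>K\<close>
  (\<open>approximation_by_simple\<close>). Hence the charges \<open>\<mu> y\<close> are separated in a uniform way.

  Uniformity is what makes the dimension drop. Consider charges whose support has exactly \<open>n\<close> points,
  one in each of \<open>n\<close> given disjoint clopen sets, and whose \<open>n\<close> weights are prescribed up to an error that
  is small compared with \<open>1 / (n K)\<close>. On such a stratum an integrand bounded by \<open>K\<close> has integrals that depend, up
  to a small error, on the positions of the support points only; so these positions determine
  the topology, and the clopen sets of \<open>X\<close> yield enough clopen subsets of the stratum
  (\<open>large_zero_dim_stratum\<close>). Without a uniform \<open>K\<close> one would only know that finitely many of the
  charges share the same positions, and a finite-to-one continuous map into a zero-dimensional space does
  not force its domain to be zero-dimensional.

  To cover everything by countably many closed strata, a countable algebra \<open>\<U>\<close> of clopen sets is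
  used instead of all of them, and \<open>Y\<close> is replaced by the metrizable space of the restrictions of the
  \<open>\<mu> y\<close> to \<open>\<U>\<close>. A closing-off argument chooses \<open>\<U>\<close> rich enough for the uniform separation to survive
  (\<open>values_0_1_separated_by_clopen\<close>). The countable closed sum theorem for normal spaces then combines the
  strata, and clopen sets of the metrizable space pull back to \<open>Y\<close>.
\<close>

section \<open>Large inductive dimension zero\<close>

text \<open>This is \<open>Ind Z \<le> 0\<close>.\<close>
definition large_zero_dim :: "'a topology \<Rightarrow> bool" where
  "large_zero_dim Z \<longleftrightarrow>
     (\<forall>A B. closedin Z A \<and> closedin Z B \<and> disjnt A B \<longrightarrow>
        (\<exists>C. closedin Z C \<and> openin Z C \<and> A \<subseteq> C \<and> disjnt B C))"

text \<open>A countable clopen cover can be made disjoint, and then a clopen set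
  separating \<open>A\<close> from \<open>B\<close> is the union of the pieces that miss \<open>B\<close>.\<close>
lemma large_zero_dim_if_countable_clopen_covers:
  assumes cover: "\<And>A B. \<lbrakk>closedin Z A; closedin Z B; disjnt A B\<rbrakk> \<Longrightarrow>
      \<exists>\<N>. countable \<N> \<and> \<Union>\<N> = topspace Z \<and>
          (\<forall>N\<in>\<N>. closedin Z N \<and> openin Z N \<and> (disjnt A N \<or> disjnt B N))"
  shows "large_zero_dim Z"
  unfolding large_zero_dim_def
proof (intro allI impI, elim conjE)
  fix A B assume AB: "closedin Z A" "closedin Z B" "disjnt A B"
  obtain \<N> where \<N>: "countable \<N>" "\<Union>\<N> = topspace Z"
    and clopen: "\<And>N. N \<in> \<N> \<Longrightarrow> closedin Z N \<and> openin Z N"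
    and miss: "\<And>N. N \<in> \<N> \<Longrightarrow> disjnt A N \<or> disjnt B N"
    using cover[OF AB] by blast
  show "\<exists>C. closedin Z C \<and> openin Z C \<and> A \<subseteq> C \<and> disjnt B C"
  proof (cases "\<N> = {}")
    case True
    then have "A = {}" using \<N>(2) closedin_subset[OF AB(1)] by simp
    then show ?thesis by (intro exI[of _ "{}"]) auto
  next
    case False
    define N where "N = from_nat_into \<N>"
    have N: "N k \<in> \<N>" for k using False by (simp add: N_def from_nat_into)
    have rangeN: "range N = \<N>" using False \<N>(1) by (simp add: N_def)
    define D where "D = disjointed N"
    have openD: "openin Z (D k)" for k
      unfolding D_def disjointed_def using clopen[OF N] by (auto intro!: openin_diff closedin_Union)
    have unionD: "(\<Union>k. D k) = topspace Z"
      using \<N>(2) rangeN by (simp add: D_def UN_disjointed_eq)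
    have DN: "D k \<subseteq> N k" for k by (simp add: D_def disjointed_subset)
    have disjD: "disjnt (D j) (D k)" if "j \<noteq> k" for j k
      using disjoint_family_disjointed[of N] that
      by (auto simp: D_def disjoint_family_on_def disjnt_def)
    define I where "I = {k. disjnt B (N k)}"
    define C where "C = (\<Union>k\<in>I. D k)"
    have openC: "openin Z C" unfolding C_def using openD by blast
    have "topspace Z - C = (\<Union>k\<in>-I. D k)"
    proof
      show "topspace Z - C \<subseteq> (\<Union>k\<in>-I. D k)"
        unfolding C_def unionD[symmetric] by blast
      show "(\<Union>k\<in>-I. D k) \<subseteq> topspace Z - C"
      proof
        fix x assume "x \<in> (\<Union>k\<in>-I. D k)"
        then obtain k where k: "k \<notin> I" "x \<in> D k" by blast
        have "x \<notin> C"
        proof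
          assume "x \<in> C"
          then obtain j where "j \<in> I" "x \<in> D j" unfolding C_def by blast
          with k disjD[of j k] show False by (auto simp: disjnt_iff)
        qed
        with k unionD show "x \<in> topspace Z - C" by blast
      qed
    qed
    moreover have "openin Z (\<Union>k\<in>-I. D k)" using openD by blast
    ultimately have "closedin Z C"
      using openC openin_subset[OF openC] by (simp add: closedin_def)
    moreover have "disjnt B C"
      using DN unfolding C_def I_def disjnt_iff by blast
    moreover have "A \<subseteq> C"
    proof
      fix x assume x: "x \<in> A"
      then obtain k where k: "x \<in> D k"
        using closedin_subset[OF AB(1)] unionD by blast
      with x DN[of k] have "\<not> disjnt A (N k)" by (auto simp: disjnt_iff)
      then have "k \<in> I" using miss[OF N] unfolding I_def by blast
      with k show "x \<in> C" unfolding C_def by blast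
    qed
    ultimately show ?thesis using openC by blast
  qed
qed

text \<open>One step of the sum theorem: split \<open>F\<close> into a clopen piece next to \<open>A\<close> and one next to \<open>B\<close>, then
  use normality to thicken both sides while keeping their closures disjoint.\<close>
lemma enlarge_separated_pair:
  assumes "normal_space Z" and F: "closedin Z F" "large_zero_dim (subtopology Z F)"
    and A: "closedin Z A" and B: "closedin Z B" and AB: "disjnt A B"
  shows "\<exists>A' B'. closedin Z A' \<and> closedin Z B' \<and> disjnt A' B' \<and>
           A \<subseteq> Z interior_of A' \<and> B \<subseteq> Z interior_of B' \<and> F \<subseteq> A' \<union> B'"
proof -
  have "closedin (subtopology Z F) (F \<inter> A)" "closedin (subtopology Z F) (F \<inter> B)"
    using A B by (simp_all add: closedin_subtopology_Int_closed)
  moreover have "disjnt (F \<inter> A) (F \<inter> B)" using AB by (auto simp: disjnt_iff)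
  ultimately obtain C where C: "closedin (subtopology Z F) C" "openin (subtopology Z F) C"
      "F \<inter> A \<subseteq> C" "disjnt (F \<inter> B) C"
    using F(2) unfolding large_zero_dim_def by blast
  have topF: "topspace (subtopology Z F) = F"
    using closedin_subset[OF F(1)] by auto
  have "closedin (subtopology Z F) (F - C)"
    using closedin_diff[OF closedin_topspace C(2)] topF by simp
  then have cl: "closedin Z C" "closedin Z (F - C)"
    using C(1) F(1) closedin_closed_subtopology by blast+
  have CF: "C \<subseteq> F" using closedin_subset[OF C(1)] topF by simp
  have "closedin Z (A \<union> C)" "closedin Z (B \<union> (F - C))"
    using A B cl by blast+
  moreover have "disjnt (A \<union> C) (B \<union> (F - C))"
    using AB C(3,4) CF by (auto simp: disjnt_iff)
  ultimately obtain U V where U: "openin Z U" "A \<union> C \<subseteq> U" and V: "openin Z V" "B \<union> (F - C) \<subseteq> V"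
    and d: "disjnt (Z closure_of U) (Z closure_of V)"
    using assms(1) unfolding normal_space_disjoint_closures by meson
  have sub: "U \<subseteq> Z closure_of U" "V \<subseteq> Z closure_of V"
    using U(1) V(1) by (simp_all add: closure_of_subset openin_subset)
  have "U \<subseteq> Z interior_of (Z closure_of U)" "V \<subseteq> Z interior_of (Z closure_of V)"
    using sub U(1) V(1) by (simp_all add: interior_of_maximal)
  then have "A \<subseteq> Z interior_of (Z closure_of U)" "B \<subseteq> Z interior_of (Z closure_of V)"
      "F \<subseteq> Z closure_of U \<union> Z closure_of V"
    using U(2) V(2) sub by blast+
  with d show ?thesis by (meson closedin_closure_of)
qed

text \<open>Starting from \<open>(A, B)\<close>, the pair is enlarged once for every member of the cover. The two
  unions are disjoint and exhaust the space; they are open because each stage lies in the interior of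
  the next.\<close>
theorem large_zero_dim_countable_closed_sum:
  assumes Z: "normal_space Z" and \<F>: "countable \<F>" "\<Union>\<F> = topspace Z"
    and F: "\<And>F. F \<in> \<F> \<Longrightarrow> closedin Z F \<and> large_zero_dim (subtopology Z F)"
  shows "large_zero_dim Z"
  unfolding large_zero_dim_def
proof (intro allI impI, elim conjE)
  fix A B assume A: "closedin Z A" and B: "closedin Z B" and AB: "disjnt A B"
  show "\<exists>C. closedin Z C \<and> openin Z C \<and> A \<subseteq> C \<and> disjnt B C"
  proof (cases "\<F> = {}")
    case True
    then have "A = {}" using \<F>(2) closedin_subset[OF A] by simp
    then show ?thesis by (intro exI[of _ "{}"]) auto
  next
    case False
    define E where "E = from_nat_into \<F>"
    have E: "closedin Z (E k)" "large_zero_dim (subtopology Z (E k))" for k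
      using F False by (simp_all add: E_def from_nat_into)
    have unionE: "(\<Union>k. E k) = topspace Z"
      using False \<F> by (metis E_def range_from_nat_into)
    define ok where "ok p \<longleftrightarrow> closedin Z (fst p) \<and> closedin Z (snd p) \<and> disjnt (fst p) (snd p)"
      for p :: "'a set \<times> 'a set"
    define step where "step k p q \<longleftrightarrow> fst p \<subseteq> Z interior_of fst q \<and> snd p \<subseteq> Z interior_of snd q \<and>
        E k \<subseteq> fst q \<union> snd q" for k and p q :: "'a set \<times> 'a set"
    have "\<exists>P. P 0 = (A, B) \<and> (\<forall>k. ok (P k) \<and> step k (P k) (P (Suc k)))"
    proof -
      have ex: "\<exists>q. ok q \<and> step k p q" if "ok p" for k p
        using enlarge_separated_pair[OF Z E, of "fst p" "snd p" k] that
        unfolding ok_def step_def by auto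
      define P where "P = rec_nat (A, B) (\<lambda>k p. SOME q. ok q \<and> step k p q)"
      have P0: "P 0 = (A, B)" by (simp add: P_def)
      have PS: "P (Suc k) = (SOME q. ok q \<and> step k (P k) q)" for k by (simp add: P_def)
      have okP: "ok (P k)" for k
      proof (induction k)
        case 0 then show ?case using A B AB by (simp add: P0 ok_def)
      next
        case (Suc k) then show ?case unfolding PS using someI_ex[OF ex] by blast
      qed
      have "step k (P k) (P (Suc k))" for k
        unfolding PS using someI_ex[OF ex[OF okP[of k], of k]] by blast
      with P0 okP show ?thesis by blast
    qed
    then obtain P where P0: "P 0 = (A, B)" and okP: "\<And>k. ok (P k)"
      and stepP: "\<And>k. step k (P k) (P (Suc k))" by blast
    have mono: "fst (P j) \<subseteq> fst (P k)" "snd (P j) \<subseteq> snd (P k)" if "j \<le> k" for j k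
      using that
    proof (induction k rule: dec_induct)
      case (step n)
      have "fst (P n) \<subseteq> fst (P (Suc n))" "snd (P n) \<subseteq> snd (P (Suc n))"
        using stepP[of n] interior_of_subset[of Z] unfolding step_def by (meson subset_trans)+
      with step.IH show "fst (P j) \<subseteq> fst (P (Suc n))" "snd (P j) \<subseteq> snd (P (Suc n))"
        by blast+
    qed auto
    define C where "C = (\<Union>k. fst (P k))"
    define D where "D = (\<Union>k. snd (P k))"
    have inner: "fst (P k) \<subseteq> Z interior_of fst (P (Suc k))" "snd (P k) \<subseteq> Z interior_of snd (P (Suc k))" for k
      using stepP[of k] unfolding step_def by simp_all
    have outer: "Z interior_of fst (P k) \<subseteq> fst (P k)" "Z interior_of snd (P k) \<subseteq> snd (P k)" for k
      by (simp_all add: interior_of_subset)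
    have "C = (\<Union>k. Z interior_of fst (P (Suc k)))"
      using inner(1) outer(1) unfolding C_def by blast
    then have openC: "openin Z C" by auto
    have "D = (\<Union>k. Z interior_of snd (P (Suc k)))"
      using inner(2) outer(2) unfolding D_def by blast
    then have openD: "openin Z D" by auto
    have disj: "disjnt C D"
    proof -
      have False if "x \<in> fst (P i)" "x \<in> snd (P j)" for x i j
      proof -
        have "x \<in> fst (P (max i j))" "x \<in> snd (P (max i j))"
          using that mono[of i "max i j"] mono[of j "max i j"] by auto
        then show False using okP[of "max i j"] unfolding ok_def by (auto simp: disjnt_iff)
      qed
      then show ?thesis unfolding C_def D_def by (auto simp: disjnt_iff)
    qed
    have "topspace Z \<subseteq> C \<union> D"
    proof
      fix x assume "x \<in> topspace Z"
      then obtain k where "x \<in> E k" using unionE by blast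
      then have "x \<in> fst (P (Suc k)) \<union> snd (P (Suc k))"
        using stepP[of k] unfolding step_def by blast
      then show "x \<in> C \<union> D" unfolding C_def D_def by blast
    qed
    then have "topspace Z - C = D"
      using disj openin_subset[OF openD] by (auto simp: disjnt_iff)
    then have "closedin Z C"
      using openD openin_subset[OF openC] by (simp add: closedin_def)
    moreover have "A \<subseteq> C" "B \<subseteq> D"
      unfolding C_def D_def using P0 UN_upper[of 0 UNIV "\<lambda>k. fst (P k)"]
        UN_upper[of 0 UNIV "\<lambda>k. snd (P k)"] by simp_all
    ultimately show ?thesis
      using openC disj by (intro exI[of _ C]) (auto simp: disjnt_iff)
  qed
qed

section \<open>Spaces of finitely supported charges\<close>

text \<open>A finitely additive signed measure on the algebra \<open>\<U>\<close>.\<close>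
definition charge :: "'a set set \<Rightarrow> ('a set \<Rightarrow> real) \<Rightarrow> bool" where
  "charge \<U> z \<longleftrightarrow> (\<forall>U\<in>\<U>. \<forall>V\<in>\<U>. disjnt U V \<longrightarrow> z (U \<union> V) = z U + z V)"

definition charged_family :: "'a set set \<Rightarrow> ('a set \<Rightarrow> real) \<Rightarrow> 'a set set \<Rightarrow> bool" where
  "charged_family \<U> z E \<longleftrightarrow> finite E \<and> E \<subseteq> \<U> \<and> disjoint E \<and> (\<forall>U\<in>E. z U \<noteq> 0)"

text \<open>A largest disjoint family of non-null sets: as far as the algebra can tell, each
  member carries exactly one point of the support.\<close>
definition concentrated :: "'a set set \<Rightarrow> ('a set \<Rightarrow> real) \<Rightarrow> 'a set set \<Rightarrow> bool" where
  "concentrated \<U> z D \<longleftrightarrow>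
     charged_family \<U> z D \<and> (\<forall>E. charged_family \<U> z E \<longrightarrow> card E \<le> card D)"

definition finite_partition_in :: "'a set \<Rightarrow> 'a set set \<Rightarrow> 'a set set \<Rightarrow> bool" where
  "finite_partition_in \<Omega> \<U> \<P> \<longleftrightarrow> finite \<P> \<and> \<P> \<subseteq> \<U> \<and> disjoint \<P> \<and> \<Union>\<P> = \<Omega>"

context algebra
begin

lemma charge_empty:
  assumes "charge M z" shows "z {} = 0"
proof -
  have "z ({} \<union> {}) = z {} + z {}"
    using assms empty_sets disjnt_empty1 unfolding charge_def by metis
  then show ?thesis by simp
qed

lemma charge_UN:
  assumes z: "charge M z" and "finite I" "\<And>i. i \<in> I \<Longrightarrow> f i \<in> M" "disjoint_family_on f I"
  shows "z (\<Union>i\<in>I. f i) = (\<Sum>i\<in>I. z (f i))"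
  using assms(2-4)
proof (induction I rule: finite_induct)
  case empty then show ?case using charge_empty[OF z] by simp
next
  case (insert i I)
  have M: "f i \<in> M" "(\<Union>j\<in>I. f j) \<in> M" using insert by auto
  have "disjnt (f i) (\<Union>j\<in>I. f j)"
    unfolding disjnt_iff
  proof (intro allI notI, elim conjE)
    fix x assume x: "x \<in> f i" "x \<in> (\<Union>j\<in>I. f j)"
    then obtain j where j: "j \<in> I" "x \<in> f j" by blast
    then have "f i \<inter> f j = {}"
      using insert.prems(2) insert.hyps(2) unfolding disjoint_family_on_def by (metis insert_iff)
    with x j show False by blast
  qed
  then have "z (f i \<union> (\<Union>j\<in>I. f j)) = z (f i) + z (\<Union>j\<in>I. f j)"
    using z M unfolding charge_def by blast
  moreover have "disjoint_family_on f I"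
    using insert.prems(2) unfolding disjoint_family_on_def by blast
  then have "z (\<Union>j\<in>I. f j) = (\<Sum>j\<in>I. z (f j))"
    using insert.IH insert.prems(1) by blast
  ultimately show ?case using insert.hyps by simp
qed

lemma charge_partition:
  assumes z: "charge M z" and \<P>: "finite_partition_in \<Omega> M \<P>" and U: "U \<in> M"
  shows "z U = (\<Sum>P\<in>\<P>. z (U \<inter> P))"
proof -
  have "U = (\<Union>P\<in>\<P>. U \<inter> P)"
    using \<P> sets_into_space[OF U] unfolding finite_partition_in_def by auto
  moreover have "z (\<Union>P\<in>\<P>. U \<inter> P) = (\<Sum>P\<in>\<P>. z (U \<inter> P))"
  proof (rule charge_UN[OF z])
    show "finite \<P>" "\<And>P. P \<in> \<P> \<Longrightarrow> U \<inter> P \<in> M"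
      using \<P> U unfolding finite_partition_in_def by auto
    show "disjoint_family_on (\<lambda>P. U \<inter> P) \<P>"
      using \<P> unfolding finite_partition_in_def disjoint_family_on_def pairwise_def disjnt_def
      by blast
  qed
  ultimately show ?thesis by simp
qed

text \<open>Two non-null pieces of \<open>U\<close> could replace \<open>U\<close> and give a larger family.\<close>
lemma concentrated_dichotomy:
  assumes z: "charge M z" and D: "concentrated M z D" and U: "U \<in> D"
    and V: "V \<in> M" "V' \<in> M" "V \<subseteq> U" "V' \<subseteq> U" "disjnt V V'"
  shows "z V = 0 \<or> z V' = 0"
proof (rule ccontr)
  assume "\<not> (z V = 0 \<or> z V' = 0)"
  then have nz: "z V \<noteq> 0" "z V' \<noteq> 0" by auto
  then have ne: "V \<noteq> {}" "V' \<noteq> {}" using charge_empty[OF z] by auto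
  have fD: "finite D" "disjoint D" using D unfolding concentrated_def charged_family_def by auto
  have off: "disjnt U X" if "X \<in> D - {U}" for X
    using fD(2) U that unfolding pairwise_def by auto
  have notin: "V \<notin> D - {U}" "V' \<notin> D - {U}" "V \<noteq> V'"
    using off V ne unfolding disjnt_iff by blast+
  let ?E = "insert V (insert V' (D - {U}))"
  have "disjoint ?E"
  proof -
    have "disjoint (D - {U})" using fD(2) pairwise_subset by blast
    moreover have "disjnt V X \<and> disjnt X V \<and> disjnt V' X \<and> disjnt X V'" if "X \<in> D - {U}" for X
      using off[OF that] V(3,4) unfolding disjnt_iff by blast
    ultimately show ?thesis using V(5) disjnt_sym[OF V(5)] by (auto simp: pairwise_insert)
  qed
  then have "charged_family M z ?E"
    using D V nz unfolding concentrated_def charged_family_def by auto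
  then have "card ?E \<le> card D" using D unfolding concentrated_def by blast
  moreover have "card ?E = card D + 1"
  proof -
    have "card (D - {U}) = card D - 1" "card D > 0"
      using fD U by (auto simp: card_gt_0_iff)
    then show ?thesis using notin fD by simp
  qed
  ultimately show False by simp
qed

lemma concentrated_outside:
  assumes z: "charge M z" and D: "concentrated M z D" and V: "V \<in> M" "disjnt V (\<Union>D)"
  shows "z V = 0"
proof (rule ccontr)
  assume nz: "z V \<noteq> 0"
  then have "V \<noteq> {}" using charge_empty[OF z] by auto
  then have "V \<notin> D" using V unfolding disjnt_iff by blast
  have "disjoint (insert V D)"
    using D V(2) unfolding concentrated_def charged_family_def pairwise_insert
    by (auto simp: disjnt_iff)
  then have "charged_family M z (insert V D)"
    using D V nz unfolding concentrated_def charged_family_def by auto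
  then have "card (insert V D) \<le> card D" using D unfolding concentrated_def by blast
  moreover have "finite D" using D unfolding concentrated_def charged_family_def by auto
  ultimately show False using \<open>V \<notin> D\<close> by simp
qed

lemma concentrated_subset_iff:
  assumes z: "charge M z" and D: "concentrated M z D" and U: "U \<in> D" and V: "V \<in> M"
  shows "z (U \<inter> V) \<noteq> 0 \<longleftrightarrow> z (U - V) = 0"
proof -
  have UM: "U \<in> M" "z U \<noteq> 0" using D U unfolding concentrated_def charged_family_def by auto
  have M: "U \<inter> V \<in> M" "U - V \<in> M" using UM V by auto
  have "disjnt (U \<inter> V) (U - V)" by (auto simp: disjnt_iff)
  then have "z ((U \<inter> V) \<union> (U - V)) = z (U \<inter> V) + z (U - V)"
    using z M unfolding charge_def by blast
  then have "z (U \<inter> V) + z (U - V) \<noteq> 0" using UM(2) by (simp add: Int_Diff_Un)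
  moreover have "z (U \<inter> V) = 0 \<or> z (U - V) = 0"
    using concentrated_dichotomy[OF z D U M] by (auto simp: disjnt_iff)
  ultimately show ?thesis by auto
qed

lemma concentrated_piece:
  assumes z: "charge M z" and D: "concentrated M z D" and U: "U \<in> D"
    and V: "V \<in> M" "z (U \<inter> V) \<noteq> 0"
  shows "z (U \<inter> V) = z U"
proof -
  have UM: "U \<in> M" using D U unfolding concentrated_def charged_family_def by auto
  have M: "U \<inter> V \<in> M" "U - V \<in> M" using UM V by auto
  have "disjnt (U \<inter> V) (U - V)" by (auto simp: disjnt_iff)
  then have "z ((U \<inter> V) \<union> (U - V)) = z (U \<inter> V) + z (U - V)"
    using z M unfolding charge_def by blast
  then show ?thesis using concentrated_subset_iff[OF z D U V(1)] V(2) by (simp add: Int_Diff_Un)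
qed

lemma concentrated_meets_partition:
  assumes z: "charge M z" and D: "concentrated M z D" and U: "U \<in> D"
    and \<P>: "finite_partition_in \<Omega> M \<P>"
  obtains P where "P \<in> \<P>" "z (U \<inter> P) \<noteq> 0"
proof -
  have UM: "U \<in> M" "z U \<noteq> 0" using D U unfolding concentrated_def charged_family_def by auto
  have "(\<Sum>P\<in>\<P>. z (U \<inter> P)) \<noteq> 0"
    using charge_partition[OF z \<P> UM(1)] UM(2) by simp
  then show ?thesis using that sum.neutral by metis
qed

text \<open>Each member of \<open>D\<close> behaves like a single support point: it sits in the one piece \<open>\<sigma> U\<close> of the partition
  and carries its whole weight there.\<close>
lemma concentrated_integral:
  assumes z: "charge M z" and D: "concentrated M z D" and \<P>: "finite_partition_in \<Omega> M \<P>"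
    and \<sigma>: "\<And>U. U \<in> D \<Longrightarrow> \<sigma> U \<in> \<P> \<and> z (U \<inter> \<sigma> U) \<noteq> 0"
  shows "(\<Sum>P\<in>\<P>. c P * z P) = (\<Sum>U\<in>D. c (\<sigma> U) * z U)"
proof -
  have fin: "finite D" "D \<subseteq> M" "disjoint D" and \<P>': "finite \<P>" "\<P> \<subseteq> M" "disjoint \<P>"
    using D \<P> unfolding concentrated_def charged_family_def finite_partition_in_def by auto
  have zP: "z P = (\<Sum>U\<in>D. z (U \<inter> P))" if P: "P \<in> \<P>" for P
  proof -
    have M: "(\<Union>U\<in>D. U \<inter> P) \<in> M" "P - \<Union>D \<in> M"
      using fin \<P>' P by (auto intro!: finite_UN finite_Union Diff)
    have "disjnt (\<Union>U\<in>D. U \<inter> P) (P - \<Union>D)" by (auto simp: disjnt_iff)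
    then have "z ((\<Union>U\<in>D. U \<inter> P) \<union> (P - \<Union>D)) = z (\<Union>U\<in>D. U \<inter> P) + z (P - \<Union>D)"
      using z M unfolding charge_def by blast
    moreover have "(\<Union>U\<in>D. U \<inter> P) \<union> (P - \<Union>D) = P" by blast
    moreover have "z (P - \<Union>D) = 0"
      using concentrated_outside[OF z D M(2)] by (auto simp: disjnt_iff)
    moreover have "z (\<Union>U\<in>D. U \<inter> P) = (\<Sum>U\<in>D. z (U \<inter> P))"
      using fin \<P>' P
      by (intro charge_UN[OF z]) (auto simp: disjoint_family_on_def pairwise_def disjnt_iff)
    ultimately show ?thesis by simp
  qed
  have "(\<Sum>P\<in>\<P>. c P * z P) = (\<Sum>P\<in>\<P>. \<Sum>U\<in>D. c P * z (U \<inter> P))"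
    by (rule sum.cong) (simp_all add: zP sum_distrib_left)
  also have "\<dots> = (\<Sum>U\<in>D. \<Sum>P\<in>\<P>. c P * z (U \<inter> P))" by (rule sum.swap)
  also have "\<dots> = (\<Sum>U\<in>D. c (\<sigma> U) * z U)"
  proof (rule sum.cong)
    fix U assume U: "U \<in> D"
    have s: "\<sigma> U \<in> \<P>" "z (U \<inter> \<sigma> U) \<noteq> 0" using \<sigma>[OF U] by auto
    have "z (U \<inter> P) = 0" if P: "P \<in> \<P> - {\<sigma> U}" for P
    proof -
      have "disjnt P (\<sigma> U)" using \<P>'(3) P s(1) unfolding pairwise_def by auto
      then have "disjnt (U \<inter> P) (U \<inter> \<sigma> U)" by (auto simp: disjnt_iff)
      moreover have "U \<inter> P \<in> M" "U \<inter> \<sigma> U \<in> M" using U P s fin \<P>' by auto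
      ultimately show ?thesis
        using concentrated_dichotomy[OF z D U, of "U \<inter> P" "U \<inter> \<sigma> U"] s(2) by blast
    qed
    then have "(\<Sum>P\<in>\<P>. c P * z (U \<inter> P)) = c (\<sigma> U) * z (U \<inter> \<sigma> U)"
      using \<P>'(1) s(1) by (subst sum.remove[of _ "\<sigma> U"]) auto
    moreover have "z (U \<inter> \<sigma> U) = z U"
      using concentrated_piece[OF z D U _ s(2)] s(1) \<P>' by blast
    ultimately show "(\<Sum>P\<in>\<P>. c P * z (U \<inter> P)) = c (\<sigma> U) * z U" by simp
  qed simp
  finally show ?thesis .
qed

end

text \<open>The last assumption is the uniform separation of a point from a closed set by integration of simple
  functions with values in \<open>[-K, K]\<close>. That \<open>K\<close> does not depend on the set is essential.\<close>
locale separating_charges = algebra \<Omega> \<U> for \<Omega> :: "'a set" and \<U> +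
  fixes S :: "('a set \<Rightarrow> real) set" and K :: real
  assumes countable_sets: "countable \<U>"
    and extensional_S: "S \<subseteq> extensional \<U>"
    and charge_S: "z \<in> S \<Longrightarrow> charge \<U> z"
    and finite_support: "z \<in> S \<Longrightarrow> \<exists>N. \<forall>E. charged_family \<U> z E \<longrightarrow> card E \<le> N"
    and separating: "\<lbrakk>closedin (subtopology (product_topology (\<lambda>_. euclideanreal) \<U>) S) A; z\<^sub>0 \<in> S - A\<rbrakk> \<Longrightarrow>
      \<exists>\<P> c. finite_partition_in \<Omega> \<U> \<P> \<and> (\<forall>P\<in>\<P>. \<bar>c P\<bar> \<le> K) \<and>
         (\<forall>z\<in>A. (\<Sum>P\<in>\<P>. c P * z\<^sub>0 P) + 1/2 \<le> (\<Sum>P\<in>\<P>. c P * z P))"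
begin

definition Z :: "('a set \<Rightarrow> real) topology" where
  "Z = subtopology (product_topology (\<lambda>_. euclideanreal) \<U>) S"

text \<open>The positions of the support points are confined to \<open>D\<close>, their weights to within \<open>\<delta>\<close> of \<open>r\<close>.\<close>
definition stratum :: "'a set set \<Rightarrow> ('a set \<Rightarrow> real) \<Rightarrow> real \<Rightarrow> ('a set \<Rightarrow> real) set" where
  "stratum D r \<delta> = {z \<in> S. concentrated \<U> z D \<and> (\<forall>U\<in>D. \<bar>z U - r U\<bar> \<le> \<delta>)}"

lemma topspace_Z: "topspace Z = S"
proof -
  have "S \<subseteq> (\<Pi>\<^sub>E U\<in>\<U>. UNIV)" using extensional_S by (auto simp: PiE_def)
  then show ?thesis by (auto simp: Z_def)
qed

lemma normal_Z: "normal_space Z"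
proof -
  have "metrizable_space (product_topology (\<lambda>_. euclideanreal) \<U>)"
    unfolding metrizable_space_product_topology
    using countable_sets metrizable_space_euclidean by auto
  then show ?thesis
    unfolding Z_def by (intro metrizable_imp_normal_space metrizable_space_subtopology)
qed

lemma continuous_map_eval:
  assumes "U \<in> \<U>" shows "continuous_map Z euclideanreal (\<lambda>z. z U)"
  unfolding Z_def
  by (intro continuous_map_from_subtopology continuous_map_product_projection assms)

text \<open>If \<open>\<delta> < \<bar>r U\<bar>\<close> then the members of \<open>D\<close> are automatically non-null, so that being concentrated on \<open>D\<close>
  reduces to the closed condition that every larger disjoint family has a null member.\<close>
lemma closedin_stratum:
  assumes D: "finite D" "D \<subseteq> \<U>" "disjoint D" and \<delta>: "\<And>U. U \<in> D \<Longrightarrow> \<delta> < \<bar>r U\<bar>"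
  shows "closedin Z (stratum D r \<delta>)"
proof -
  let ?\<E> = "{E. finite E \<and> E \<subseteq> \<U> \<and> disjoint E \<and> card E > card D}"
  let ?zero = "\<lambda>U. {z \<in> topspace Z. z U \<in> {0::real}}"
  let ?near = "\<lambda>U. {z \<in> topspace Z. z U \<in> {r U - \<delta>..r U + \<delta>}}"
  have cl: "closedin Z {z \<in> topspace Z. z U \<in> C}" if "U \<in> \<U>" "closed C" for U and C :: "real set"
    using closedin_continuous_map_preimage[OF continuous_map_eval[OF that(1)], of C] that(2) by simp
  define R where "R = \<Inter>(insert (topspace Z) ((\<lambda>E. \<Union>(?zero ` E)) ` ?\<E> \<union> ?near ` D))"
  have "stratum D r \<delta> = R"
  proof (rule set_eqI)
    fix z
    have near_iff: "z U \<in> {r U - \<delta>..r U + \<delta>} \<longleftrightarrow> \<bar>z U - r U\<bar> \<le> \<delta>" for U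
      by (auto simp: abs_le_iff)
    have "z \<in> R \<longleftrightarrow> z \<in> S \<and> (\<forall>E\<in>?\<E>. z \<in> \<Union>(?zero ` E)) \<and> (\<forall>U\<in>D. z \<in> ?near U)"
      unfolding R_def Inter_iff ball_simps(7) ball_Un ball_simps(9) topspace_Z by simp
    then have "z \<in> R \<longleftrightarrow> z \<in> S \<and> (\<forall>E\<in>?\<E>. \<exists>U\<in>E. z U = 0) \<and> (\<forall>U\<in>D. \<bar>z U - r U\<bar> \<le> \<delta>)"
      using near_iff by (simp add: topspace_Z cong: conj_cong)
    moreover have "(\<forall>E\<in>?\<E>. \<exists>U\<in>E. z U = 0) \<longleftrightarrow> concentrated \<U> z D"
      if "\<forall>U\<in>D. \<bar>z U - r U\<bar> \<le> \<delta>"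
    proof -
      have "z U \<noteq> 0" if "U \<in> D" for U
        using that \<delta>[OF that] \<open>\<forall>U\<in>D. \<bar>z U - r U\<bar> \<le> \<delta>\<close> by force
      then have "charged_family \<U> z D" using D unfolding charged_family_def by blast
      moreover have "(\<forall>E\<in>?\<E>. \<exists>U\<in>E. z U = 0) \<longleftrightarrow>
          (\<forall>E. charged_family \<U> z E \<longrightarrow> card E \<le> card D)"
        unfolding charged_family_def not_less[symmetric] by blast
      ultimately show ?thesis unfolding concentrated_def by blast
    qed
    ultimately show "z \<in> stratum D r \<delta> \<longleftrightarrow> z \<in> R"
      unfolding stratum_def mem_Collect_eq by argo
  qed
  moreover have "closedin Z R"
    unfolding R_def
  proof (rule closedin_Inter)
    have zero: "closedin Z (\<Union>(?zero ` E))" if "E \<in> ?\<E>" for E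
    proof (rule closedin_Union)
      show "finite (?zero ` E)" using that by simp
      show "closedin Z T" if "T \<in> ?zero ` E" for T
        using that \<open>E \<in> ?\<E>\<close> by (elim imageE) (simp only:, rule cl, auto)
    qed
    have near: "closedin Z (?near U)" if "U \<in> D" for U
      using that D(2) by (intro cl) auto
    fix T assume "T \<in> insert (topspace Z) ((\<lambda>E. \<Union>(?zero ` E)) ` ?\<E> \<union> ?near ` D)"
    then show "closedin Z T"
      by (elim insertE UnE imageE; simp only: closedin_topspace zero near)
  qed simp
  ultimately show ?thesis by simp
qed

text \<open>For a choice \<open>\<sigma>\<close> of subsets, the charges whose support point in \<open>U\<close> lies in \<open>\<sigma> U\<close> for all \<open>U \<in> D\<close> form a
  clopen subset of the stratum. If \<open>\<sigma>\<close> comes from a partition, integrals of a function that is constant on its pieces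
  vary over this set by at most \<open>n K 2\<delta> < 1/2\<close> (where \<open>n = card D\<close>), because only the weights can change.
  Hence it does not reach a closed set from which its centre is separated by \<open>1/2\<close>.\<close>
lemma large_zero_dim_stratum:
  assumes D: "finite D" "D \<subseteq> \<U>" "disjoint D" and \<delta>: "\<And>U. U \<in> D \<Longrightarrow> \<delta> < \<bar>r U\<bar>"
    and small: "real (card D) * (\<bar>K\<bar> * (2 * \<delta>)) < 1/2"
  shows "large_zero_dim (subtopology Z (stratum D r \<delta>))"
proof (rule large_zero_dim_if_countable_clopen_covers)
  let ?W = "stratum D r \<delta>"
  let ?T = "subtopology Z ?W"
  have W: "closedin Z ?W" by (rule closedin_stratum[OF D \<delta>])
  have topT: "topspace ?T = ?W" using closedin_subset[OF W] by auto
  have WS: "z \<in> S" "concentrated \<U> z D" "charge \<U> z" if "z \<in> ?W" for z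
    using that charge_S unfolding stratum_def by auto
  define N where "N \<sigma> = {z \<in> ?W. \<forall>U\<in>D. z (U \<inter> \<sigma> U) \<noteq> 0}" for \<sigma> :: "'a set \<Rightarrow> 'a set"
  have cl: "closedin ?T {z \<in> ?W. z V = 0}" if "V \<in> \<U>" for V
    using closedin_continuous_map_preimage[OF
        continuous_map_from_subtopology[OF continuous_map_eval[OF that], of ?W], of "{0}"]
    unfolding topT by simp
  have clopenN: "closedin ?T (N \<sigma>) \<and> openin ?T (N \<sigma>)" if \<sigma>: "\<sigma> \<in> D \<rightarrow>\<^sub>E \<U>" for \<sigma>
  proof -
    have M: "U \<inter> \<sigma> U \<in> \<U>" "U - \<sigma> U \<in> \<U>" if "U \<in> D" for U
      using that \<sigma> D by (auto dest!: PiE_mem)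
    have iff: "z (U \<inter> \<sigma> U) \<noteq> 0 \<longleftrightarrow> z (U - \<sigma> U) = 0" if "z \<in> ?W" "U \<in> D" for z U
      using concentrated_subset_iff[OF WS(3,2)] PiE_mem[OF \<sigma>] that by blast
    have "N \<sigma> = \<Inter>(insert ?W ((\<lambda>U. {z \<in> ?W. z (U - \<sigma> U) = 0}) ` D))" (is "_ = ?R")
      using iff unfolding N_def by fastforce
    moreover have "closedin ?T ?R"
      using cl M(2) closedin_topspace[of ?T] unfolding topT
      by (intro closedin_Inter) auto
    moreover have "?W - N \<sigma> = \<Union>((\<lambda>U. {z \<in> ?W. z (U \<inter> \<sigma> U) = 0}) ` D)" (is "_ = ?Q")
      unfolding N_def by blast
    moreover have "closedin ?T ?Q"
      using cl M(1) D(1) by (intro closedin_Union) auto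
    ultimately show ?thesis
      unfolding openin_closedin_eq topT by (simp add: N_def)
  qed
  fix A B assume A: "closedin ?T A" and B: "closedin ?T B" and AB: "disjnt A B"
  let ?\<N> = "N ` {\<sigma> \<in> D \<rightarrow>\<^sub>E \<U>. disjnt A (N \<sigma>) \<or> disjnt B (N \<sigma>)}"
  have avoid: "\<exists>\<sigma>\<in>D \<rightarrow>\<^sub>E \<U>. z\<^sub>0 \<in> N \<sigma> \<and> disjnt A' (N \<sigma>)"
    if A': "closedin ?T A'" and z0: "z\<^sub>0 \<in> ?W" "z\<^sub>0 \<notin> A'" for A' z\<^sub>0
  proof -
    have "closedin Z A'" using A' W closedin_closed_subtopology by blast
    then obtain \<P> c where \<P>: "finite_partition_in \<Omega> \<U> \<P>" and c: "\<And>P. P \<in> \<P> \<Longrightarrow> \<bar>c P\<bar> \<le> K"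
      and gap: "\<And>z. z \<in> A' \<Longrightarrow> (\<Sum>P\<in>\<P>. c P * z\<^sub>0 P) + 1/2 \<le> (\<Sum>P\<in>\<P>. c P * z P)"
      using separating[of A' z\<^sub>0] z0 WS(1) unfolding Z_def by blast
    define \<sigma> where "\<sigma> = (\<lambda>U\<in>D. SOME P. P \<in> \<P> \<and> z\<^sub>0 (U \<inter> P) \<noteq> 0)"
    have \<sigma>: "\<sigma> U \<in> \<P> \<and> z\<^sub>0 (U \<inter> \<sigma> U) \<noteq> 0" if U: "U \<in> D" for U
    proof -
      have "\<exists>P. P \<in> \<P> \<and> z\<^sub>0 (U \<inter> P) \<noteq> 0"
        using concentrated_meets_partition[OF WS(3,2)[OF z0(1)] U \<P>] by blast
      from someI_ex[OF this] show ?thesis using U by (simp add: \<sigma>_def)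
    qed
    have "\<sigma> \<in> D \<rightarrow>\<^sub>E \<U>"
    proof
      show "\<sigma> U \<in> \<U>" if "U \<in> D" for U
        using \<sigma>[OF that] \<P> unfolding finite_partition_in_def by blast
    qed (simp add: \<sigma>_def)
    moreover have "z\<^sub>0 \<in> N \<sigma>" using \<sigma> z0(1) by (simp add: N_def)
    moreover have False if z: "z \<in> A'" "z \<in> N \<sigma>" for z
    proof -
      have zW: "z \<in> ?W" and z\<sigma>: "\<And>U. U \<in> D \<Longrightarrow> \<sigma> U \<in> \<P> \<and> z (U \<inter> \<sigma> U) \<noteq> 0"
        using z(2) \<sigma> by (auto simp: N_def)
      have "(\<Sum>P\<in>\<P>. c P * z P) - (\<Sum>P\<in>\<P>. c P * z\<^sub>0 P) =
          (\<Sum>U\<in>D. c (\<sigma> U) * z U) - (\<Sum>U\<in>D. c (\<sigma> U) * z\<^sub>0 U)"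
        using concentrated_integral[OF WS(3,2)[OF zW] \<P> z\<sigma>, of c]
          concentrated_integral[OF WS(3,2)[OF z0(1)] \<P> \<sigma>, of c] by simp
      also have "\<dots> = (\<Sum>U\<in>D. c (\<sigma> U) * (z U - z\<^sub>0 U))"
        by (simp add: sum_subtractf right_diff_distrib)
      also have "\<dots> \<le> (\<Sum>U\<in>D. \<bar>K\<bar> * (2 * \<delta>))"
      proof (rule sum_mono)
        fix U assume U: "U \<in> D"
        have "\<bar>z U - r U\<bar> \<le> \<delta>" "\<bar>z\<^sub>0 U - r U\<bar> \<le> \<delta>"
          using zW z0(1) U unfolding stratum_def by auto
        then have "\<bar>z U - z\<^sub>0 U\<bar> \<le> 2 * \<delta>" by linarith
        moreover have "\<bar>c (\<sigma> U)\<bar> \<le> \<bar>K\<bar>" using c[of "\<sigma> U"] \<sigma>[OF U] by linarith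
        ultimately have "\<bar>c (\<sigma> U) * (z U - z\<^sub>0 U)\<bar> \<le> \<bar>K\<bar> * (2 * \<delta>)"
          unfolding abs_mult by (intro mult_mono) auto
        then show "c (\<sigma> U) * (z U - z\<^sub>0 U) \<le> \<bar>K\<bar> * (2 * \<delta>)" by linarith
      qed
      also have "\<dots> < 1/2" using small by simp
      finally show False using gap[OF z(1)] by simp
    qed
    ultimately show ?thesis by (auto simp: disjnt_iff)
  qed
  have "countable ?\<N>"
  proof -
    have "countable (D \<rightarrow>\<^sub>E \<U>)" using D(1) countable_sets by (intro countable_PiE) auto
    then show ?thesis by (intro countable_image) (rule countable_subset[rotated], auto)
  qed
  moreover have "\<Union>?\<N> = topspace ?T"
  proof
    show "\<Union>?\<N> \<subseteq> topspace ?T" unfolding topT N_def by blast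
    show "topspace ?T \<subseteq> \<Union>?\<N>"
    proof
      fix z assume z: "z \<in> topspace ?T"
      then have zW: "z \<in> ?W" unfolding topT .
      from AB have "z \<notin> A \<or> z \<notin> B" by (auto simp: disjnt_iff)
      then show "z \<in> \<Union>?\<N>" using avoid[OF A zW] avoid[OF B zW] by blast
    qed
  qed
  ultimately show "\<exists>\<N>. countable \<N> \<and> \<Union>\<N> = topspace ?T \<and>
      (\<forall>N\<in>\<N>. closedin ?T N \<and> openin ?T N \<and> (disjnt A N \<or> disjnt B N))"
    using clopenN by (intro exI[of _ ?\<N>]) blast
qed

lemma exists_concentrated:
  assumes "z \<in> S" obtains D where "concentrated \<U> z D"
proof -
  obtain N where N: "\<forall>E. charged_family \<U> z E \<longrightarrow> card E \<le> N"
    using finite_support[OF assms] by blast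
  have "charged_family \<U> z {}" by (simp add: charged_family_def)
  then have "\<exists>D. charged_family \<U> z D \<and> (\<forall>E. charged_family \<U> z E \<longrightarrow> card E \<le> card D)"
    using N by (intro ex_has_greatest_nat[of "charged_family \<U> z" "{}" card "Suc N"]) (auto simp: less_Suc_eq_le)
  then show ?thesis using that unfolding concentrated_def by blast
qed

text \<open>Rational parameters keep the strata countable in number.\<close>
lemma exists_stratum:
  assumes z: "z \<in> S"
  obtains D r \<delta> where "finite D" "D \<subseteq> \<U>" "disjoint D" "r \<in> D \<rightarrow>\<^sub>E \<rat>" "\<delta> \<in> \<rat>"
    "\<And>U. U \<in> D \<Longrightarrow> \<delta> < \<bar>r U\<bar>" "real (card D) * (\<bar>K\<bar> * (2 * \<delta>)) < 1/2" "z \<in> stratum D r \<delta>"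
proof -
  obtain D where D: "concentrated \<U> z D" using exists_concentrated[OF z] .
  then have D': "finite D" "D \<subseteq> \<U>" "disjoint D" "\<And>U. U \<in> D \<Longrightarrow> z U \<noteq> 0"
    unfolding concentrated_def charged_family_def by auto
  \<comment> \<open>The summand 1 keeps the bound positive when \<open>D\<close> is empty or \<open>K = 0\<close>.\<close>
  define b where "b = real (card D) * (2 * \<bar>K\<bar>) + 1"
  have b: "b > 0" unfolding b_def by (intro add_nonneg_pos mult_nonneg_nonneg) auto
  define e where "e = Min (insert (1 / (2 * b)) ((\<lambda>U. \<bar>z U\<bar> / 2) ` D))"
  have "e > 0" using D' b unfolding e_def by (subst Min_gr_iff) auto
  then obtain \<delta> where \<delta>: "\<delta> \<in> \<rat>" "0 < \<delta>" "\<delta> < e" using Rats_dense_in_real by blast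
  have e: "e \<le> 1 / (2 * b)" "\<And>U. U \<in> D \<Longrightarrow> e \<le> \<bar>z U\<bar> / 2"
    unfolding e_def by (rule Min_le; use D'(1) in simp)+
  have "\<exists>q\<in>\<rat>. \<bar>z U - q\<bar> < \<delta>" for U
  proof -
    obtain q where "q \<in> \<rat>" "z U - \<delta> < q" "q < z U + \<delta>"
      using Rats_dense_in_real[of "z U - \<delta>" "z U + \<delta>"] \<delta> by auto
    then show ?thesis by (intro bexI[of _ q]) (auto simp: abs_less_iff)
  qed
  then obtain q where q: "\<And>U. q U \<in> \<rat>" "\<And>U. \<bar>z U - q U\<bar> < \<delta>" by metis
  show ?thesis
  proof (rule that[of D "restrict q D" \<delta>])
    show "\<delta> < \<bar>restrict q D U\<bar>" if "U \<in> D" for U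
      using e(2)[OF that] \<delta>(3) q(2)[of U] that by auto
    have "real (card D) * (\<bar>K\<bar> * (2 * \<delta>)) \<le> b * \<delta>"
      using \<delta>(2) by (simp add: b_def algebra_simps)
    also have "\<dots> < b * (1 / (2 * b))" using b \<delta>(3) e(1) by (intro mult_strict_left_mono) auto
    also have "\<dots> = 1/2" using b by simp
    finally show "real (card D) * (\<bar>K\<bar> * (2 * \<delta>)) < 1/2" .
    show "z \<in> stratum D (restrict q D) \<delta>"
      using z D q(2) by (auto simp: stratum_def less_imp_le)
  qed (use D' \<delta> q(1) in auto)
qed

theorem large_zero_dim_Z: "large_zero_dim Z"
proof -
  define good where "good D r \<delta> \<longleftrightarrow> (\<forall>U\<in>D. \<delta> < \<bar>r U\<bar>) \<and> disjoint D \<and>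
      real (card D) * (\<bar>K\<bar> * (2 * \<delta>)) < 1/2" for D :: "'a set set" and r \<delta>
  let ?D = "{D. finite D \<and> D \<subseteq> \<U>}"
  let ?I = "Sigma ?D (\<lambda>D. (D \<rightarrow>\<^sub>E \<rat>) \<times> \<rat>)"
  let ?\<F> = "(\<lambda>(D, r, \<delta>). stratum D r \<delta>) ` {(D, r, \<delta>) \<in> ?I. good D r \<delta>}"
  have "countable ?I"
    using countable_sets by (intro countable_SIGMA countable_Collect_finite_subset countable_PiE countable_rat) auto
  then have "countable ?\<F>" by (intro countable_image) (rule countable_subset[rotated], auto)
  moreover have "\<Union>?\<F> = topspace Z"
  proof
    show "\<Union>?\<F> \<subseteq> topspace Z" unfolding topspace_Z stratum_def by auto
    show "topspace Z \<subseteq> \<Union>?\<F>"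
    proof
      fix z assume "z \<in> topspace Z"
      then obtain D r \<delta> where "finite D" "D \<subseteq> \<U>" "disjoint D" "r \<in> D \<rightarrow>\<^sub>E \<rat>" "\<delta> \<in> \<rat>"
        "\<And>U. U \<in> D \<Longrightarrow> \<delta> < \<bar>r U\<bar>" "real (card D) * (\<bar>K\<bar> * (2 * \<delta>)) < 1/2" "z \<in> stratum D r \<delta>"
        using exists_stratum unfolding topspace_Z by metis
      then have I: "(D, r, \<delta>) \<in> {(D, r, \<delta>) \<in> ?I. good D r \<delta>}" and z: "z \<in> stratum D r \<delta>"
        by (simp_all add: good_def)
      from imageI[OF I, of "\<lambda>(D, r, \<delta>). stratum D r \<delta>"] have "stratum D r \<delta> \<in> ?\<F>"
        by (simp only: prod.case)
      with z show "z \<in> \<Union>?\<F>" by (rule UnionI[rotated])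
    qed
  qed
  moreover have "closedin Z F \<and> large_zero_dim (subtopology Z F)" if F\<F>: "F \<in> ?\<F>" for F
  proof -
    obtain D r \<delta> where "finite D" "D \<subseteq> \<U>" "good D r \<delta>" and F: "F = stratum D r \<delta>"
      using F\<F> by auto
    then show ?thesis
      unfolding F good_def by (intro conjI closedin_stratum large_zero_dim_stratum) auto
  qed
  ultimately show ?thesis by (rule large_zero_dim_countable_closed_sum[OF normal_Z])
qed

end

section \<open>Bounded continuous functions, clopen sets and covering dimension zero\<close>

abbreviation BC :: "'a topology \<Rightarrow> ('a \<Rightarrow> real) set" where
  "BC \<equiv> bounded_continuous_functions"

lemma BC_boundedE:
  assumes "f \<in> BC X" obtains B where "\<And>x. x \<in> topspace X \<Longrightarrow> \<bar>f x\<bar> \<le> B"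
proof -
  from assms have "bounded (f ` topspace X)" by (simp add: bounded_continuous_functions_def)
  then obtain B where "\<forall>v\<in>f ` topspace X. norm v \<le> B" unfolding bounded_iff by blast
  then show ?thesis using that[of B] by simp
qed

lemma BC_restrictI:
  assumes "continuous_map X euclideanreal f" "\<And>x. x \<in> topspace X \<Longrightarrow> \<bar>f x\<bar> \<le> B"
  shows "restrict f (topspace X) \<in> BC X"
proof -
  have "continuous_map X euclideanreal (restrict f (topspace X))"
    by (rule continuous_map_eq[OF assms(1)]) simp
  moreover have "bounded (restrict f (topspace X) ` topspace X)"
    unfolding bounded_iff using assms(2) by (intro exI[of _ B]) auto
  ultimately show ?thesis by (simp add: bounded_continuous_functions_def)
qed

lemma BC_zero: "(\<lambda>x\<in>topspace X. 0) \<in> BC X"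
  by (rule BC_restrictI[of _ _ 0]) auto

lemma BC_diff:
  assumes "f \<in> BC X" "g \<in> BC X"
  shows "(\<lambda>x\<in>topspace X. f x - g x) \<in> BC X"
proof -
  have "(\<lambda>x\<in>topspace X. f x - g x) =
      (\<lambda>x\<in>topspace X. f x + (\<lambda>x\<in>topspace X. (- 1) * g x) x)"
    by (auto simp: fun_eq_iff)
  then show ?thesis
    using bounded_continuous_functions_add[OF assms(1) bounded_continuous_functions_cmult[OF assms(2), of "- 1"]]
    by simp
qed

text \<open>The Baire category theorem for the sup norm, phrased without reference to a metric.\<close>
lemma BC_Baire:
  fixes C :: "nat \<Rightarrow> ('a \<Rightarrow> real) set"
  assumes ne: "topspace X \<noteq> {}" and cover: "BC X = (\<Union>n. C n)"
    and closed: "\<And>n. \<forall>f\<in>BC X. (\<forall>\<epsilon>>0. \<exists>g\<in>C n. \<forall>x\<in>topspace X. \<bar>f x - g x\<bar> \<le> \<epsilon>) \<longrightarrow> f \<in> C n"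
  shows "\<exists>n. \<exists>f\<in>BC X. \<exists>r>0. \<forall>g\<in>BC X. (\<forall>x\<in>topspace X. \<bar>g x - f x\<bar> \<le> r) \<longrightarrow> g \<in> C n"
proof -
  let ?m = "cfunspace X (euclidean_metric :: real metric)"
  have sp: "mspace ?m = BC X"
    unfolding mspace_cfunspace bounded_continuous_functions_def by auto
  interpret F: Metric_space "mspace ?m" "mdist ?m" by (rule Metric_space_mspace_mdist)
  have top: "topspace F.mtopology = BC X"
    unfolding F.topspace_mtopology by (rule sp)
  have dist: "mdist ?m f g \<le> a \<longleftrightarrow> (\<forall>x\<in>topspace X. \<bar>f x - g x\<bar> \<le> a)"
    if "f \<in> BC X" "g \<in> BC X" for f g a
    using cfunspace_mdist_le[of f X euclidean_metric g a] that ne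
    unfolding sp by (simp add: dist_real_def)
  have "mcomplete_of ?m"
  proof -
    have "Metric_space.Self (UNIV::real set) dist = euclidean_metric"
      unfolding Met_TC.Self_def euclidean_metric_def ..
    moreover have "Met_TC.mcomplete (TYPE(real))" by (simp add: complete_UNIV)
    ultimately show ?thesis using Met_TC.mcomplete_cfunspace[of X, where ?'a = real] by simp
  qed
  then have complete: F.mcomplete unfolding mcomplete_of_def .
  have CB: "C n \<subseteq> BC X" for n using cover by blast
  have closedC: "closedin F.mtopology (C n)" for n
  proof -
    have "F.mtopology closure_of (C n) \<subseteq> C n"
    proof
      fix f assume "f \<in> F.mtopology closure_of (C n)"
      then have *: "f \<in> mspace ?m \<and> (\<forall>r>0. \<exists>g\<in>C n. g \<in> F.mcball f r)"
        unfolding F.metric_closure_of_alt by (rule CollectD)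
      then have f: "f \<in> BC X" unfolding sp by blast
      have near: "\<exists>g\<in>C n. mdist ?m f g \<le> \<epsilon>" if "\<epsilon> > 0" for \<epsilon>
        using * that unfolding F.in_mcball by blast
      show "f \<in> C n"
      proof (rule closed[rule_format, OF f])
        fix \<epsilon> :: real assume "\<epsilon> > 0"
        then obtain g where "g \<in> C n" "mdist ?m f g \<le> \<epsilon>" using near by blast
        then show "\<exists>g\<in>C n. \<forall>x\<in>topspace X. \<bar>f x - g x\<bar> \<le> \<epsilon>"
          using dist[OF f, of g \<epsilon>] CB by blast
      qed
    qed
    then show ?thesis using CB[of n] closure_of_subset_eq[of "C n" F.mtopology] unfolding top by blast
  qed
  have "\<exists>n. F.mtopology interior_of (C n) \<noteq> {}"
  proof (rule ccontr)
    assume "\<nexists>n. F.mtopology interior_of (C n) \<noteq> {}"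
    then have "F.mtopology interior_of \<Union>(range C) = {}"
      using closedC by (intro F.metric_Baire_category_alt[OF complete]) auto
    moreover have "\<Union>(range C) = topspace F.mtopology" unfolding top cover ..
    ultimately have "topspace F.mtopology = {}" using interior_of_topspace by metis
    then show False using BC_zero[of X] unfolding top by blast
  qed
  then obtain n f where "f \<in> F.mtopology interior_of (C n)" by blast
  then have *: "f \<in> mspace ?m \<and> (\<exists>e>0. F.mball f e \<subseteq> C n)"
    unfolding F.metric_interior_of by (rule CollectD)
  then have f: "f \<in> BC X" unfolding sp by blast
  from * obtain e where e: "e > 0" "F.mball f e \<subseteq> C n" by blast
  show ?thesis
  proof (intro exI bexI conjI ballI impI)
    show "f \<in> BC X" by (rule f)
    show "e/2 > 0" using e by simp
    fix g assume g: "g \<in> BC X" "\<forall>x\<in>topspace X. \<bar>g x - f x\<bar> \<le> e/2"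
    have "mdist ?m f g \<le> e/2"
      unfolding dist[OF f g(1)] by (metis g(2) abs_minus_commute)
    then have "mdist ?m f g < e" using e(1) by linarith
    moreover have "g \<in> mspace ?m" unfolding sp by (rule g(1))
    ultimately have "g \<in> F.mball f e" using * unfolding F.in_mball by blast
    then show "g \<in> C n" using e(2) by blast
  qed
qed

definition clopens :: "'a topology \<Rightarrow> 'a set set" where
  "clopens X = {U. closedin X U \<and> openin X U}"

definition ind :: "'a topology \<Rightarrow> 'a set \<Rightarrow> 'a \<Rightarrow> real" where
  "ind X U = (\<lambda>x\<in>topspace X. indicator U x)"

lemma algebra_clopens: "algebra (topspace X) (clopens X)"
  unfolding algebra_iff_Int clopens_def
  using closedin_subset by (auto intro: closedin_diff openin_diff)

lemma ind_in_BC: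
  assumes "U \<in> clopens X" shows "ind X U \<in> BC X"
  unfolding ind_def
proof (rule BC_restrictI[of _ _ 1])
  have U: "openin X U" "openin X (topspace X - U)" using assms by (auto simp: clopens_def)
  show "continuous_map X euclideanreal (indicator U)"
    unfolding continuous_map_def
  proof (intro conjI allI impI)
    fix O' :: "real set"
    have "{x \<in> topspace X. indicator U x \<in> O'} =
        (if 1 \<in> O' then U else {}) \<union> (if (0::real) \<in> O' then topspace X - U else {})"
      using openin_subset[OF U(1)] by (auto simp: indicator_def)
    then show "openin X {x \<in> topspace X. indicator U x \<in> O'}" using U by auto
  qed simp
qed (simp add: indicator_def)

text \<open>Refine the cover by the sets on which \<open>f\<close> is within \<open>\<eta>/2\<close> of a multiple of \<open>\<eta>/2\<close>. A cover of
  multiplicity one is a partition into clopen sets, and a value attained by \<open>f\<close> serves as the constant on each piece,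
  so that the bound \<open>B\<close> is preserved.\<close>
lemma simple_approximation:
  assumes dim: "covering_dim_le X 0" and f: "f \<in> BC X"
    and B: "\<And>x. x \<in> topspace X \<Longrightarrow> \<bar>f x\<bar> \<le> B" and \<eta>: "\<eta> > 0"
  obtains \<P> c where "finite_partition_in (topspace X) (clopens X) \<P>"
    "\<And>P. P \<in> \<P> \<Longrightarrow> \<bar>c P\<bar> \<le> B" "\<And>P x. \<lbrakk>P \<in> \<P>; x \<in> P\<rbrakk> \<Longrightarrow> \<bar>f x - c P\<bar> \<le> \<eta>"
proof -
  have contf: "continuous_map X euclideanreal f"
    using f by (simp add: bounded_continuous_functions_def)
  define e where "e = \<eta> / 2"
  have e: "e > 0" using \<eta> by (simp add: e_def)
  define J where "J k = {x \<in> topspace X. \<bar>f x / e - real_of_int k\<bar> < 1}" for k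
  define m where "m = \<lceil>B / e\<rceil> + 1"
  have "functionally_open_in X (J k)" for k
    unfolding functionally_open_in_def
  proof (intro exI conjI)
    show "continuous_map X euclideanreal (\<lambda>x. max 0 (1 - \<bar>f x / e - real_of_int k\<bar>))"
      by (intro continuous_intros contf) (use e in auto)
    show "J k = {x \<in> topspace X. max 0 (1 - \<bar>f x / e - real_of_int k\<bar>) \<noteq> 0}"
      by (auto simp: J_def max_def)
  qed
  moreover have "\<Union>(J ` {- m..m}) = topspace X"
  proof
    show "\<Union>(J ` {- m..m}) \<subseteq> topspace X" by (auto simp: J_def)
    show "topspace X \<subseteq> \<Union>(J ` {- m..m})"
    proof
      fix x assume x: "x \<in> topspace X"
      have "\<bar>f x / e\<bar> \<le> B / e" using B[OF x] e by (simp add: divide_right_mono)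
      then have "\<lfloor>f x / e\<rfloor> \<in> {- m..m}" unfolding m_def atLeastAtMost_iff by linarith
      moreover have "x \<in> J \<lfloor>f x / e\<rfloor>" unfolding J_def using x by (simp) linarith
      ultimately show "x \<in> \<Union>(J ` {- m..m})" by blast
    qed
  qed
  ultimately have "finite_functionally_open_cover X (J ` {- m..m})"
    unfolding finite_functionally_open_cover_def by blast
  then obtain \<V> where \<V>: "finite_functionally_open_cover X \<V>"
    and ref: "\<forall>V\<in>\<V>. \<exists>U\<in>J ` {- m..m}. V \<subseteq> U"
    and card: "\<forall>x\<in>topspace X. card {V \<in> \<V>. x \<in> V} \<le> 0 + 1"
    using dim unfolding covering_dim_le_def by blast
  have fin: "finite \<V>" and union: "\<Union>\<V> = topspace X"
    and fo: "\<And>V. V \<in> \<V> \<Longrightarrow> functionally_open_in X V"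
    using \<V> unfolding finite_functionally_open_cover_def by auto
  have opn: "openin X V" if V\<V>: "V \<in> \<V>" for V
  proof -
    obtain h where h: "continuous_map X euclideanreal h" "V = {x \<in> topspace X. h x \<noteq> 0}"
      using fo[OF V\<V>] unfolding functionally_open_in_def by blast
    have "openin X {x \<in> topspace X. h x \<in> - {0}}"
      by (rule openin_continuous_map_preimage[OF h(1)]) auto
    then show ?thesis using h(2) by simp
  qed
  have disj: "disjnt V V'" if "V \<in> \<V>" "V' \<in> \<V>" "V \<noteq> V'" for V V'
    unfolding disjnt_iff
  proof (intro allI notI, elim conjE)
    fix x assume x: "x \<in> V" "x \<in> V'"
    then have "x \<in> topspace X" using that union by blast
    have "card {V, V'} \<le> card {V \<in> \<V>. x \<in> V}"
      using fin that x by (intro card_mono) auto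
    moreover have "card {V \<in> \<V>. x \<in> V} \<le> 1" using card \<open>x \<in> topspace X\<close> by simp
    ultimately show False using that(3) by simp
  qed
  define \<P> where "\<P> = \<V> - {{}}"
  have clop: "P \<in> clopens X" if P: "P \<in> \<P>" for P
  proof -
    have P': "P \<in> \<V>" using P by (simp add: \<P>_def)
    have "topspace X - P = \<Union>(\<V> - {P})"
    proof
      show "topspace X - P \<subseteq> \<Union>(\<V> - {P})" unfolding union[symmetric] by blast
      show "\<Union>(\<V> - {P}) \<subseteq> topspace X - P"
        unfolding union[symmetric] using disj[OF _ P'] by (auto simp: disjnt_iff)
    qed
    moreover have "openin X (\<Union>(\<V> - {P}))" using opn by blast
    ultimately show ?thesis
      using opn[OF P'] openin_subset[OF opn[OF P']] by (simp add: clopens_def closedin_def)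
  qed
  have part: "finite_partition_in (topspace X) (clopens X) \<P>"
    unfolding finite_partition_in_def pairwise_def
    using fin clop disj union by (auto simp: \<P>_def)
  define c where "c P = f (SOME x. x \<in> P)" for P
  have some: "(SOME x. x \<in> P) \<in> P" if "P \<in> \<P>" for P
    using that by (metis \<P>_def Diff_iff insertI1 some_in_eq)
  show ?thesis
  proof (rule that[OF part])
    fix P assume P: "P \<in> \<P>"
    have "P \<subseteq> topspace X" using P union by (auto simp: \<P>_def)
    then show "\<bar>c P\<bar> \<le> B" using some[OF P] B unfolding c_def by blast
    fix x assume x: "x \<in> P"
    obtain k where k: "P \<subseteq> J k" using ref P unfolding \<P>_def by blast
    have "\<bar>f x / e - real_of_int k\<bar> < 1" "\<bar>c P / e - real_of_int k\<bar> < 1"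
      using k x some[OF P] unfolding J_def c_def by auto
    then have "\<bar>f x / e - c P / e\<bar> \<le> 2" by linarith
    then have "\<bar>(f x - c P) / e\<bar> \<le> 2" by (simp add: diff_divide_distrib)
    then show "\<bar>f x - c P\<bar> \<le> \<eta>" using e by (simp add: e_def field_simps)
  qed
qed

text \<open>For a finite cozero cover, normalise the defining functions so that at every point one of them
  equals \<open>1\<close>. Clopen sets separating the values \<open>0\<close> and \<open>1\<close> then shrink the cover to a clopen one, which
  can be made disjoint.\<close>
lemma covering_dim_le_0_if_separated:
  assumes sep: "\<And>g. \<lbrakk>continuous_map Y euclideanreal g; \<And>y. y \<in> topspace Y \<Longrightarrow> 0 \<le> g y \<and> g y \<le> 1\<rbrakk> \<Longrightarrow>
      \<exists>C\<in>clopens Y. (\<forall>y\<in>topspace Y. (g y = 0 \<longrightarrow> y \<notin> C) \<and> (g y = 1 \<longrightarrow> y \<in> C))"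
  shows "covering_dim_le Y 0"
  unfolding covering_dim_le_def
proof (intro allI impI)
  fix \<U> assume \<U>: "finite_functionally_open_cover Y \<U>"
  then have fin: "finite \<U>" and union: "\<Union>\<U> = topspace Y"
    and fo: "\<And>U. U \<in> \<U> \<Longrightarrow> functionally_open_in Y U"
    unfolding finite_functionally_open_cover_def by auto
  interpret clopens: algebra "topspace Y" "clopens Y" by (rule algebra_clopens)
  have "\<exists>g. continuous_map Y euclideanreal g \<and> U = {y \<in> topspace Y. g y \<noteq> 0}" if "U \<in> \<U>" for U
    using fo[OF that] unfolding functionally_open_in_def .
  then obtain g where g: "\<And>U. U \<in> \<U> \<Longrightarrow> continuous_map Y euclideanreal (g U)"
    and gU: "\<And>U. U \<in> \<U> \<Longrightarrow> U = {y \<in> topspace Y. g U y \<noteq> 0}" by metis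
  define s where "s y = (\<Sum>U\<in>\<U>. \<bar>g U y\<bar>)" for y
  have s_pos: "s y > 0" if y: "y \<in> topspace Y" for y
  proof -
    obtain U where U: "U \<in> \<U>" "y \<in> U" using y union by blast
    then have "0 < \<bar>g U y\<bar>" using gU by auto
    also have "\<dots> \<le> s y" unfolding s_def using fin U by (intro member_le_sum) auto
    finally show ?thesis .
  qed
  \<comment> \<open>Some \<open>\<bar>g U y\<bar> / s y\<close> is at least the mean \<open>1 / card \<U>\<close>, so the factor \<open>n\<close> lifts it above \<open>1\<close>.\<close>
  define n where "n = real (card \<U>) + 1"
  have n: "n \<ge> 1" by (simp add: n_def)
  define h where "h U y = min 1 (n * \<bar>g U y\<bar> / s y)" for U y
  have s_cont: "continuous_map Y euclideanreal s"
    unfolding s_def by (intro continuous_map_sum fin continuous_map_real_abs g)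
  have h_cont: "continuous_map Y euclideanreal (h U)" if "U \<in> \<U>" for U
    unfolding h_def
    by (intro continuous_map_real_min continuous_map_real_divide continuous_map_real_mult_left
        continuous_map_real_abs g[OF that] s_cont) (use s_pos in force)+
  have h_range: "0 \<le> h U y \<and> h U y \<le> 1" if "y \<in> topspace Y" for U y
    using s_pos[OF that] n by (simp add: h_def)
  have "\<exists>C\<in>clopens Y. \<forall>y\<in>topspace Y. (h U y = 0 \<longrightarrow> y \<notin> C) \<and> (h U y = 1 \<longrightarrow> y \<in> C)"
    if "U \<in> \<U>" for U
    by (rule sep[OF h_cont[OF that] h_range])
  then obtain C where C: "\<And>U. U \<in> \<U> \<Longrightarrow> C U \<in> clopens Y"
    and C0: "\<And>U y. \<lbrakk>U \<in> \<U>; y \<in> topspace Y; h U y = 0\<rbrakk> \<Longrightarrow> y \<notin> C U"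
    and C1: "\<And>U y. \<lbrakk>U \<in> \<U>; y \<in> topspace Y; h U y = 1\<rbrakk> \<Longrightarrow> y \<in> C U" by metis
  have CU: "C U \<subseteq> U" if U: "U \<in> \<U>" for U
  proof
    fix y assume y: "y \<in> C U"
    then have yY: "y \<in> topspace Y" using C[OF U] clopens.sets_into_space by blast
    then have "h U y \<noteq> 0" using C0[OF U] y by blast
    then have "g U y \<noteq> 0" by (auto simp: h_def)
    then show "y \<in> U" using gU[OF U] yY by blast
  qed
  have C_cover: "\<exists>U\<in>\<U>. y \<in> C U" if y: "y \<in> topspace Y" for y
  proof (rule ccontr)
    assume "\<not> (\<exists>U\<in>\<U>. y \<in> C U)"
    then have "h U y \<noteq> 1" if "U \<in> \<U>" for U using C1[OF that y] that by blast
    then have less: "n * \<bar>g U y\<bar> \<le> s y" if "U \<in> \<U>" for U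
      using that s_pos[OF y] by (force simp: h_def min_def divide_simps split: if_splits)
    have "n * s y = (\<Sum>U\<in>\<U>. n * \<bar>g U y\<bar>)" by (simp add: s_def sum_distrib_left)
    also have "\<dots> \<le> real (card \<U>) * s y" using less by (rule sum_bounded_above)
    finally show False using s_pos[OF y] by (simp add: n_def algebra_simps)
  qed
  obtain u :: "nat \<Rightarrow> 'a set" and k where u: "u ` {..<k} = \<U>"
    using fin by (metis finite_imp_nat_seg_image_inj_on lessThan_def)
  define D where "D i = C (u i) - (\<Union>j<i. C (u j))" for i
  have D_clopen: "D i \<in> clopens Y" if "i < k" for i
    unfolding D_def using u that C by (intro clopens.Diff clopens.finite_UN) auto
  have D_disj: "i = j" if "y \<in> D i" "y \<in> D j" for y i j
    using that unfolding D_def by (metis DiffD1 DiffD2 UN_I lessThan_iff linorder_neqE_nat)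
  let ?\<V> = "D ` {..<k}"
  have "finite_functionally_open_cover Y ?\<V>"
    unfolding finite_functionally_open_cover_def
  proof (intro conjI ballI)
    fix V assume "V \<in> ?\<V>"
    then have V: "V \<in> clopens Y" using D_clopen by blast
    then have "continuous_map Y euclideanreal (ind Y V)"
      using ind_in_BC by (auto simp: bounded_continuous_functions_def)
    moreover have "V = {y \<in> topspace Y. ind Y V y \<noteq> 0}"
      using clopens.sets_into_space[OF V] by (auto simp: ind_def indicator_def)
    ultimately show "functionally_open_in Y V" unfolding functionally_open_in_def by blast
  next
    show "\<Union>?\<V> = topspace Y"
    proof
      show "\<Union>?\<V> \<subseteq> topspace Y" using D_clopen clopens.sets_into_space by blast
      show "topspace Y \<subseteq> \<Union>?\<V>"
      proof
        fix y assume y: "y \<in> topspace Y"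
        obtain U where "U \<in> \<U>" "y \<in> C U" using C_cover[OF y] by blast
        then have ex: "\<exists>i. i < k \<and> y \<in> C (u i)" using u by blast
        define i where "i = (LEAST i. i < k \<and> y \<in> C (u i))"
        have i: "i < k" "y \<in> C (u i)" using LeastI_ex[OF ex] unfolding i_def by auto
        have "y \<notin> C (u j)" if "j < i" for j
          using not_less_Least[of j "\<lambda>i. i < k \<and> y \<in> C (u i)"] that i(1) unfolding i_def by auto
        then have "y \<in> D i" using i by (simp add: D_def)
        then show "y \<in> \<Union>?\<V>" using i(1) by blast
      qed
    qed
  qed simp
  moreover have "\<forall>V\<in>?\<V>. \<exists>U\<in>\<U>. V \<subseteq> U"
  proof
    fix V assume "V \<in> ?\<V>"
    then obtain i where i: "i < k" "V = D i" by blast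
    then have "u i \<in> \<U>" using u by blast
    then show "\<exists>U\<in>\<U>. V \<subseteq> U" using CU i(2) unfolding D_def by blast
  qed
  moreover have "\<forall>y\<in>topspace Y. card {V \<in> ?\<V>. y \<in> V} \<le> 0 + 1"
  proof
    fix y
    have "V = V'" if "V \<in> ?\<V>" "y \<in> V" "V' \<in> ?\<V>" "y \<in> V'" for V V'
      using that D_disj by auto
    then show "card {V \<in> ?\<V>. y \<in> V} \<le> 0 + 1"
      using card_le_Suc0_iff_eq[of "{V \<in> ?\<V>. y \<in> V}"] by auto
  qed
  ultimately show "\<exists>\<V>. finite_functionally_open_cover Y \<V> \<and> (\<forall>V\<in>\<V>. \<exists>U\<in>\<U>. V \<subseteq> U) \<and>
      (\<forall>x\<in>topspace Y. card {V \<in> \<V>. x \<in> V} \<le> 0 + 1)" by blast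
qed

text \<open>Closing off a countable set under a finitary operation with countable values.\<close>
lemma countable_closure_exists:
  assumes A0: "countable A\<^sub>0" "A\<^sub>0 \<subseteq> A"
    and \<Phi>: "\<And>F. \<lbrakk>finite F; F \<subseteq> A\<rbrakk> \<Longrightarrow> countable (\<Phi> F) \<and> \<Phi> F \<subseteq> A"
  obtains B where "countable B" "A\<^sub>0 \<subseteq> B" "B \<subseteq> A" "\<And>F. \<lbrakk>finite F; F \<subseteq> B\<rbrakk> \<Longrightarrow> \<Phi> F \<subseteq> B"
proof -
  define step where "step B = B \<union> \<Union>(\<Phi> ` {F. finite F \<and> F \<subseteq> B})" for B
  define G where "G n = (step ^^ n) A\<^sub>0" for n
  have G_Suc: "G (Suc n) = step (G n)" for n by (simp add: G_def)
  have G: "countable (G n) \<and> G n \<subseteq> A" for n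
  proof (induction n)
    case 0 then show ?case using A0 by (simp add: G_def)
  next
    case (Suc n)
    then have fins: "countable {F. finite F \<and> F \<subseteq> G n}"
      using countable_Collect_finite_subset by blast
    have each: "countable (\<Phi> F)" "\<Phi> F \<subseteq> A" if "F \<in> {F. finite F \<and> F \<subseteq> G n}" for F
      using \<Phi>[of F] that Suc by auto
    have "countable (\<Union>(\<Phi> ` {F. finite F \<and> F \<subseteq> G n}))"
      by (rule countable_UN[OF fins each(1)])
    moreover have "\<Union>(\<Phi> ` {F. finite F \<and> F \<subseteq> G n}) \<subseteq> A"
      by (rule UN_least[OF each(2)])
    ultimately show ?case using Suc unfolding G_Suc step_def by simp
  qed
  have mono: "incseq G" by (rule incseq_SucI) (auto simp: G_Suc step_def)
  show ?thesis
  proof (rule that[of "\<Union>n. G n"])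
    show "A\<^sub>0 \<subseteq> (\<Union>n. G n)" using UN_upper[of 0 UNIV G] by (simp add: G_def)
    fix F assume F: "finite F" "F \<subseteq> (\<Union>n. G n)"
    have "\<exists>n. F \<subseteq> G n"
      using F
    proof (induction F rule: finite_induct)
      case (insert x F)
      then obtain i j where "F \<subseteq> G i" "x \<in> G j" by blast
      then have "insert x F \<subseteq> G (max i j)"
        using incseqD[OF mono, of i "max i j"] incseqD[OF mono, of j "max i j"] by auto
      then show ?case by blast
    qed simp
    then obtain n where "F \<subseteq> G n" by blast
    then have "\<Phi> F \<subseteq> G (Suc n)" using F(1) unfolding G_Suc step_def by blast
    then show "\<Phi> F \<subseteq> (\<Union>n. G n)" by blast
  qed (use G in auto)
qed

section \<open>Continuous linear surjections and their charges\<close>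

locale Cp_star_surjection =
  fixes X :: "'a topology" and Y :: "'b topology" and T :: "('a \<Rightarrow> real) \<Rightarrow> 'b \<Rightarrow> real"
  assumes X_nonempty: "topspace X \<noteq> {}" and Y_nonempty: "topspace Y \<noteq> {}"
    and linear: "linear_Cp_star X Y T"
    and continuous: "continuous_map (Cp_star X) (Cp_star Y) T"
    and onto: "T ` topspace (Cp_star X) = topspace (Cp_star Y)"
begin

lemma T_add:
  "\<lbrakk>f \<in> BC X; g \<in> BC X; y \<in> topspace Y\<rbrakk> \<Longrightarrow> T (\<lambda>x\<in>topspace X. f x + g x) y = T f y + T g y"
  using linear unfolding linear_Cp_star_def by blast

lemma T_cmult:
  "\<lbrakk>f \<in> BC X; y \<in> topspace Y\<rbrakk> \<Longrightarrow> T (\<lambda>x\<in>topspace X. c * f x) y = c * T f y"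
  using linear unfolding linear_Cp_star_def by blast

lemma T_zero: "y \<in> topspace Y \<Longrightarrow> T (\<lambda>x\<in>topspace X. 0) y = 0"
  using T_cmult[OF BC_zero, of y 0] by (simp cong: restrict_cong)

lemma T_diff:
  assumes "f \<in> BC X" "g \<in> BC X" "y \<in> topspace Y"
  shows "T (\<lambda>x\<in>topspace X. f x - g x) y = T f y - T g y"
proof -
  have "(\<lambda>x\<in>topspace X. f x - g x) =
      (\<lambda>x\<in>topspace X. f x + (\<lambda>x\<in>topspace X. (- 1) * g x) x)"
    by (auto simp: fun_eq_iff)
  then show ?thesis
    using T_add[OF assms(1) bounded_continuous_functions_cmult[OF assms(2), of "- 1"] assms(3)]
      T_cmult[OF assms(2,3), of "- 1"] by simp
qed

lemma T_sum:
  assumes "finite I" "\<And>i. i \<in> I \<Longrightarrow> f i \<in> BC X"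
  shows "(\<lambda>x\<in>topspace X. \<Sum>i\<in>I. c i * f i x) \<in> BC X \<and>
    (\<forall>y\<in>topspace Y. T (\<lambda>x\<in>topspace X. \<Sum>i\<in>I. c i * f i x) y = (\<Sum>i\<in>I. c i * T (f i) y))"
  using assms
proof (induction I rule: finite_induct)
  case empty
  then show ?case using T_zero BC_zero unfolding sum.empty by blast
next
  case (insert i I)
  let ?F = "\<lambda>x\<in>topspace X. c i * f i x" and ?G = "\<lambda>x\<in>topspace X. \<Sum>j\<in>I. c j * f j x"
  have fi: "f i \<in> BC X" using insert.prems by blast
  have G: "?G \<in> BC X" "\<And>y. y \<in> topspace Y \<Longrightarrow> T ?G y = (\<Sum>j\<in>I. c j * T (f j) y)"
  proof -
    have "?G \<in> BC X \<and> (\<forall>y\<in>topspace Y. T ?G y = (\<Sum>j\<in>I. c j * T (f j) y))"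
      by (rule insert.IH) (use insert.prems in blast)
    then show "?G \<in> BC X" "\<And>y. y \<in> topspace Y \<Longrightarrow> T ?G y = (\<Sum>j\<in>I. c j * T (f j) y)"
      by blast+
  qed
  have F: "?F \<in> BC X" by (rule bounded_continuous_functions_cmult[OF fi])
  have eq: "(\<lambda>x\<in>topspace X. \<Sum>j\<in>insert i I. c j * f j x) = (\<lambda>x\<in>topspace X. ?F x + ?G x)"
    using insert.hyps by (auto simp: fun_eq_iff)
  show ?case
    unfolding eq
  proof (intro conjI ballI)
    show "(\<lambda>x\<in>topspace X. ?F x + ?G x) \<in> BC X" by (rule bounded_continuous_functions_add[OF F G(1)])
    fix y assume y: "y \<in> topspace Y"
    show "T (\<lambda>x\<in>topspace X. ?F x + ?G x) y = (\<Sum>j\<in>insert i I. c j * T (f j) y)"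
      unfolding T_add[OF F G(1) y] T_cmult[OF fi y] G(2)[OF y] using insert.hyps by simp
  qed
qed

lemma T_in: "f \<in> BC X \<Longrightarrow> T f \<in> BC Y"
  by (metis imageI onto topspace_Cp_star)

lemma T_onto: "g \<in> BC Y \<Longrightarrow> \<exists>f\<in>BC X. T f = g"
  by (metis imageE onto topspace_Cp_star)

lemma continuous_T: "f \<in> BC X \<Longrightarrow> continuous_map Y euclideanreal (T f)"
  using T_in unfolding bounded_continuous_functions_def by blast

text \<open>Pointwise continuity at \<open>0\<close> controls \<open>T f y\<close> by the values of \<open>f\<close> at finitely many points. This is stronger than
  boundedness of the functional: it also gives the finite support of the charge.\<close>
lemma T_local_bound:
  assumes y: "y \<in> topspace Y"
  obtains S c where "finite S" "S \<subseteq> topspace X" "c > 0"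
    "\<And>f r. \<lbrakk>f \<in> BC X; r > 0; \<And>x. x \<in> S \<Longrightarrow> \<bar>f x\<bar> \<le> r\<rbrakk> \<Longrightarrow> \<bar>T f y\<bar> \<le> c * r"
proof -
  let ?P = "product_topology (\<lambda>_. euclideanreal) (topspace X)"
  have "continuous_map (Cp_star Y) euclideanreal (\<lambda>g. g y)"
    unfolding Cp_star_def
    by (intro continuous_map_from_subtopology continuous_map_product_projection y)
  from continuous_map_compose[OF continuous this]
  have "continuous_map (Cp_star X) euclideanreal (\<lambda>f. T f y)" by (simp add: o_def)
  then have "openin (Cp_star X) {f \<in> topspace (Cp_star X). T f y \<in> {-1<..<1}}"
    by (rule openin_continuous_map_preimage) simp
  then obtain W where W: "openin ?P W" and
    eq: "{f \<in> BC X. T f y \<in> {-1<..<1}} = W \<inter> BC X"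
    unfolding topspace_Cp_star by (auto simp: Cp_star_def openin_subtopology)
  have "(\<lambda>x\<in>topspace X. 0) \<in> {f \<in> BC X. T f y \<in> {-1<..<1}}"
    using BC_zero T_zero[OF y] by simp
  then have "(\<lambda>x\<in>topspace X. 0) \<in> W" unfolding eq by blast
  from bspec[OF W[unfolded openin_product_topology_alt] this]
  obtain V where V: "finite {x \<in> topspace X. V x \<noteq> topspace euclideanreal}"
      "\<And>x. x \<in> topspace X \<Longrightarrow> openin euclideanreal (V x)"
      "(\<lambda>x\<in>topspace X. 0) \<in> Pi\<^sub>E (topspace X) V" "Pi\<^sub>E (topspace X) V \<subseteq> W"
    by (elim exE conjE) (rule that; (assumption | erule bspec, assumption))
  define S where "S = {x \<in> topspace X. V x \<noteq> UNIV}"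
  have S: "finite S" "S \<subseteq> topspace X" using V(1) by (auto simp: S_def)
  have "\<exists>e>0. \<forall>t. \<bar>t\<bar> < e \<longrightarrow> t \<in> V x" if x: "x \<in> S" for x
  proof -
    have xX: "x \<in> topspace X" using x S by blast
    have "open (V x)" "0 \<in> V x" using V(2)[OF xX] PiE_mem[OF V(3) xX] xX by auto
    then obtain e where "e > 0" "ball 0 e \<subseteq> V x" by (meson openE)
    then show ?thesis by (intro exI[of _ e]) (auto simp: dist_real_def)
  qed
  then obtain e where e: "\<And>x. x \<in> S \<Longrightarrow> e x > 0" "\<And>x t. \<lbrakk>x \<in> S; \<bar>t\<bar> < e x\<rbrakk> \<Longrightarrow> t \<in> V x"
    by metis
  define d where "d = Min (insert 1 (e ` S))"
  have d: "d > 0" using S(1) e(1) unfolding d_def by (subst Min_gr_iff) auto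
  have de: "d \<le> e x" if "x \<in> S" for x
    unfolding d_def using S(1) that by (intro Min_le) auto
  show ?thesis
  proof (rule that[OF S, of "2 / d"])
    show "2 / d > 0" using d by simp
    fix f r assume f: "f \<in> BC X" and r: "(r::real) > 0" and small: "\<And>x. x \<in> S \<Longrightarrow> \<bar>f x\<bar> \<le> r"
    let ?k = "d / (2 * r)"
    have k: "?k > 0" using d r by simp
    let ?g = "\<lambda>x\<in>topspace X. ?k * f x"
    have g: "?g \<in> BC X" by (rule bounded_continuous_functions_cmult[OF f])
    have "?g \<in> Pi\<^sub>E (topspace X) V"
    proof (rule PiE_I)
      fix x assume x: "x \<in> topspace X"
      show "?g x \<in> V x"
      proof (cases "x \<in> S")
        case True
        have "\<bar>?k * f x\<bar> = ?k * \<bar>f x\<bar>"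
          using k by (simp only: abs_mult abs_of_pos)
        also have "\<dots> \<le> ?k * r" using small[OF True] k by (intro mult_left_mono) auto
        also have "\<dots> < d" using r d by simp
        finally have "\<bar>?k * f x\<bar> < e x" using de[OF True] by linarith
        then show ?thesis using e(2)[OF True] x by simp
      next
        case False
        then show ?thesis using x by (simp add: S_def)
      qed
    qed simp
    then have "?g \<in> W \<inter> BC X" using V(4) g by blast
    then have "\<bar>T ?g y\<bar> < 1" unfolding eq[symmetric] by auto
    then have "\<bar>?k * T f y\<bar> < 1" unfolding T_cmult[OF f y] .
    then have "?k * \<bar>T f y\<bar> < 1" using k by (simp only: abs_mult abs_of_pos)
    then have "\<bar>T f y\<bar> < 1 / ?k" using k by (simp only: pos_less_divide_eq mult.commute)
    then show "\<bar>T f y\<bar> \<le> 2 / d * r" by simp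
  qed
qed

text \<open>Uniform boundedness: the functions whose image is bounded by \<open>n\<close> form a closed set, so one of these
  sets contains a ball.\<close>
lemma T_bounded:
  obtains M where "M > 0"
    "\<And>f r y. \<lbrakk>f \<in> BC X; r > 0; \<And>x. x \<in> topspace X \<Longrightarrow> \<bar>f x\<bar> \<le> r; y \<in> topspace Y\<rbrakk> \<Longrightarrow> \<bar>T f y\<bar> \<le> M * r"
proof -
  define C where "C n = {f \<in> BC X. \<forall>y\<in>topspace Y. \<bar>T f y\<bar> \<le> real n}" for n
  have cover: "BC X = (\<Union>n. C n)"
  proof
    show "BC X \<subseteq> (\<Union>n. C n)"
    proof
      fix f assume f: "f \<in> BC X"
      obtain B where B: "\<And>y. y \<in> topspace Y \<Longrightarrow> \<bar>T f y\<bar> \<le> B" using BC_boundedE[OF T_in[OF f]] by metis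
      obtain n where "B \<le> real n" using real_arch_simple by blast
      then have "f \<in> C n" using f B unfolding C_def by force
      then show "f \<in> (\<Union>n. C n)" by blast
    qed
  qed (auto simp: C_def)
  have closed: "\<forall>f\<in>BC X. (\<forall>\<epsilon>>0. \<exists>g\<in>C n. \<forall>x\<in>topspace X. \<bar>f x - g x\<bar> \<le> \<epsilon>) \<longrightarrow> f \<in> C n" for n
  proof (intro ballI impI)
    fix f assume f: "f \<in> BC X" and near: "\<forall>\<epsilon>>0. \<exists>g\<in>C n. \<forall>x\<in>topspace X. \<bar>f x - g x\<bar> \<le> \<epsilon>"
    have "\<bar>T f y\<bar> \<le> real n" if y: "y \<in> topspace Y" for y
    proof (rule field_le_epsilon)
      fix e :: real assume e: "e > 0"
      obtain S c where S: "S \<subseteq> topspace X" "c > 0" and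
        bound: "\<And>f r. \<lbrakk>f \<in> BC X; r > 0; \<And>x. x \<in> S \<Longrightarrow> \<bar>f x\<bar> \<le> r\<rbrakk> \<Longrightarrow> \<bar>T f y\<bar> \<le> c * r"
        using T_local_bound[OF y] by metis
      have ec: "e / c > 0" using e S by simp
      then obtain g where g: "g \<in> C n" "\<forall>x\<in>topspace X. \<bar>f x - g x\<bar> \<le> e / c"
        using near by blast
      then have gBC: "g \<in> BC X" "\<bar>T g y\<bar> \<le> real n" using y by (auto simp: C_def)
      have "\<bar>T (\<lambda>x\<in>topspace X. f x - g x) y\<bar> \<le> c * (e / c)"
        using S(1) g(2) by (intro bound BC_diff f gBC(1) ec) auto
      then have "\<bar>T f y - T g y\<bar> \<le> e" using T_diff[OF f gBC(1) y] S(2) by simp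
      then show "\<bar>T f y\<bar> \<le> real n + e" using gBC(2) by linarith
    qed
    then show "f \<in> C n" using f by (simp add: C_def)
  qed
  obtain n f\<^sub>0 \<rho> where f0: "f\<^sub>0 \<in> BC X" and \<rho>: "\<rho> > 0"
    and ball: "\<forall>g\<in>BC X. (\<forall>x\<in>topspace X. \<bar>g x - f\<^sub>0 x\<bar> \<le> \<rho>) \<longrightarrow> g \<in> C n"
    using BC_Baire[OF X_nonempty cover closed] by blast
  show ?thesis
  proof (rule that[of "(2 * real n + 1) / \<rho>"])
    show "(2 * real n + 1) / \<rho> > 0" using \<rho> by simp
    fix f r y assume f: "f \<in> BC X" and r: "(r::real) > 0"
      and fr: "\<And>x. x \<in> topspace X \<Longrightarrow> \<bar>f x\<bar> \<le> r" and y: "y \<in> topspace Y"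
    let ?h = "\<lambda>x\<in>topspace X. (\<rho> / r) * f x"
    let ?g = "\<lambda>x\<in>topspace X. f\<^sub>0 x + ?h x"
    have h: "?h \<in> BC X" by (rule bounded_continuous_functions_cmult[OF f])
    have "?g \<in> C n"
    proof (rule ball[rule_format])
      show "?g \<in> BC X" by (rule bounded_continuous_functions_add[OF f0 h])
      fix x assume x: "x \<in> topspace X"
      have "\<bar>(\<rho> / r) * f x\<bar> = (\<rho> / r) * \<bar>f x\<bar>" using \<rho> r by (simp add: abs_mult)
      also have "\<dots> \<le> (\<rho> / r) * r" using fr[OF x] \<rho> r by (intro mult_left_mono) auto
      finally show "\<bar>?g x - f\<^sub>0 x\<bar> \<le> \<rho>" using x r by simp
    qed
    moreover have "f\<^sub>0 \<in> C n" by (rule ball[rule_format, OF f0]) (use \<rho> in simp)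
    ultimately have "\<bar>T ?g y\<bar> \<le> real n" "\<bar>T f\<^sub>0 y\<bar> \<le> real n" using y by (auto simp: C_def)
    moreover have "T ?g y = T f\<^sub>0 y + (\<rho> / r) * T f y"
      unfolding T_add[OF f0 h y] T_cmult[OF f y] ..
    ultimately have "\<bar>(\<rho> / r) * T f y\<bar> \<le> 2 * real n + 1" by linarith
    then have "(\<rho> / r) * \<bar>T f y\<bar> \<le> 2 * real n + 1" using \<rho> r by (simp add: abs_mult)
    then show "\<bar>T f y\<bar> \<le> (2 * real n + 1) / \<rho> * r" using \<rho> r by (simp add: field_simps)
  qed
qed

text \<open>The Baire half of the open mapping theorem: the closure of the image of some ball contains a ball. An
  approximate solution suffices for the later argument.\<close>
lemma T_almost_open:
  assumes \<eta>: "\<eta> > 0"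
  obtains K where
    "\<And>h. \<lbrakk>h \<in> BC Y; \<And>y. y \<in> topspace Y \<Longrightarrow> \<bar>h y\<bar> \<le> 1\<rbrakk> \<Longrightarrow>
       \<exists>f\<in>BC X. (\<forall>x\<in>topspace X. \<bar>f x\<bar> \<le> K) \<and> (\<forall>y\<in>topspace Y. \<bar>T f y - h y\<bar> \<le> \<eta>)"
proof -
  define C where "C n = {g \<in> BC Y. \<forall>\<epsilon>>0. \<exists>f\<in>BC X. (\<forall>x\<in>topspace X. \<bar>f x\<bar> \<le> real n) \<and>
      (\<forall>y\<in>topspace Y. \<bar>T f y - g y\<bar> \<le> \<epsilon>)}" for n
  have CD: "\<exists>f\<in>BC X. (\<forall>x\<in>topspace X. \<bar>f x\<bar> \<le> real n) \<and> (\<forall>y\<in>topspace Y. \<bar>T f y - g y\<bar> \<le> \<epsilon>)"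
    if "g \<in> C n" "\<epsilon> > 0" for g n \<epsilon>
    using that unfolding C_def by simp
  have cover: "BC Y = (\<Union>n. C n)"
  proof
    show "BC Y \<subseteq> (\<Union>n. C n)"
    proof
      fix g assume g: "g \<in> BC Y"
      then obtain f where f: "f \<in> BC X" "T f = g" using T_onto by blast
      obtain B where B: "\<And>x. x \<in> topspace X \<Longrightarrow> \<bar>f x\<bar> \<le> B" using BC_boundedE[OF f(1)] by metis
      obtain n where n: "B \<le> real n" using real_arch_simple by blast
      have "\<bar>f x\<bar> \<le> real n" if "x \<in> topspace X" for x using B[OF that] n by linarith
      then have "g \<in> C n" unfolding C_def using f g by force
      then show "g \<in> (\<Union>n. C n)" by blast
    qed
  qed (auto simp: C_def)
  have closed: "\<forall>g\<in>BC Y. (\<forall>\<epsilon>>0. \<exists>g'\<in>C n. \<forall>y\<in>topspace Y. \<bar>g y - g' y\<bar> \<le> \<epsilon>) \<longrightarrow> g \<in> C n" for n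
  proof (intro ballI impI)
    fix g assume g: "g \<in> BC Y" and near: "\<forall>\<epsilon>>0. \<exists>g'\<in>C n. \<forall>y\<in>topspace Y. \<bar>g y - g' y\<bar> \<le> \<epsilon>"
    have "\<exists>f\<in>BC X. (\<forall>x\<in>topspace X. \<bar>f x\<bar> \<le> real n) \<and> (\<forall>y\<in>topspace Y. \<bar>T f y - g y\<bar> \<le> \<epsilon>)"
      if "\<epsilon> > 0" for \<epsilon>
    proof -
      have e: "\<epsilon> / 2 > 0" using that by simp
      obtain g' where g': "g' \<in> C n" "\<And>y. y \<in> topspace Y \<Longrightarrow> \<bar>g y - g' y\<bar> \<le> \<epsilon> / 2"
        using near e by blast
      then obtain f where f: "f \<in> BC X" "\<forall>x\<in>topspace X. \<bar>f x\<bar> \<le> real n"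
          "\<And>y. y \<in> topspace Y \<Longrightarrow> \<bar>T f y - g' y\<bar> \<le> \<epsilon> / 2"
        using e unfolding C_def by blast
      have "\<bar>T f y - g y\<bar> \<le> \<epsilon>" if "y \<in> topspace Y" for y
        using f(3)[OF that] g'(2)[OF that] by linarith
      with f show ?thesis by blast
    qed
    then show "g \<in> C n" using g unfolding C_def by blast
  qed
  obtain n h\<^sub>0 \<rho> where h0: "h\<^sub>0 \<in> BC Y" and \<rho>: "\<rho> > 0"
    and ball: "\<forall>g\<in>BC Y. (\<forall>y\<in>topspace Y. \<bar>g y - h\<^sub>0 y\<bar> \<le> \<rho>) \<longrightarrow> g \<in> C n"
    using BC_Baire[OF Y_nonempty cover closed] by blast
  show ?thesis
  proof (rule that[of "2 * real n / \<rho>"])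
    fix h assume h: "h \<in> BC Y" and h1: "\<And>y. y \<in> topspace Y \<Longrightarrow> \<bar>h y\<bar> \<le> 1"
    let ?k = "\<lambda>y\<in>topspace Y. \<rho> * h y"
    let ?g = "\<lambda>y\<in>topspace Y. h\<^sub>0 y + ?k y"
    have gC: "?g \<in> C n"
    proof (rule ball[rule_format])
      show "?g \<in> BC Y"
        by (rule bounded_continuous_functions_add[OF h0 bounded_continuous_functions_cmult[OF h]])
      fix y assume y: "y \<in> topspace Y"
      have "\<bar>\<rho> * h y\<bar> \<le> \<rho> * 1"
        unfolding abs_mult using h1[OF y] \<rho> by (intro mult_mono) auto
      then show "\<bar>?g y - h\<^sub>0 y\<bar> \<le> \<rho>" using y by simp
    qed
    have h0C: "h\<^sub>0 \<in> C n" by (rule ball[rule_format, OF h0]) (use \<rho> in simp)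
    have e: "\<rho> * \<eta> / 2 > 0" using \<rho> \<eta> by simp
    obtain f\<^sub>1 where f1: "f\<^sub>1 \<in> BC X" "\<And>x. x \<in> topspace X \<Longrightarrow> \<bar>f\<^sub>1 x\<bar> \<le> real n"
        "\<And>y. y \<in> topspace Y \<Longrightarrow> \<bar>T f\<^sub>1 y - ?g y\<bar> \<le> \<rho> * \<eta> / 2"
      using CD[OF gC e] by blast
    obtain f\<^sub>0 where f0: "f\<^sub>0 \<in> BC X" "\<And>x. x \<in> topspace X \<Longrightarrow> \<bar>f\<^sub>0 x\<bar> \<le> real n"
        "\<And>y. y \<in> topspace Y \<Longrightarrow> \<bar>T f\<^sub>0 y - h\<^sub>0 y\<bar> \<le> \<rho> * \<eta> / 2"
      using CD[OF h0C e] by blast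
    let ?d = "\<lambda>x\<in>topspace X. f\<^sub>1 x - f\<^sub>0 x"
    let ?f = "\<lambda>x\<in>topspace X. (1 / \<rho>) * ?d x"
    have d: "?d \<in> BC X" by (rule BC_diff[OF f1(1) f0(1)])
    have "?f \<in> BC X" by (rule bounded_continuous_functions_cmult[OF d])
    moreover have "\<bar>?f x\<bar> \<le> 2 * real n / \<rho>" if x: "x \<in> topspace X" for x
    proof -
      have "\<bar>f\<^sub>1 x - f\<^sub>0 x\<bar> \<le> 2 * real n" using f1(2)[OF x] f0(2)[OF x] by linarith
      then have "\<bar>f\<^sub>1 x - f\<^sub>0 x\<bar> / \<rho> \<le> 2 * real n / \<rho>" using \<rho> by (intro divide_right_mono) auto
      then show ?thesis using x \<rho> by simp
    qed
    moreover have "\<bar>T ?f y - h y\<bar> \<le> \<eta>" if y: "y \<in> topspace Y" for y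
    proof -
      have "T ?f y = (1 / \<rho>) * (T f\<^sub>1 y - T f\<^sub>0 y)"
        unfolding T_cmult[OF d y] T_diff[OF f1(1) f0(1) y] ..
      then have "\<rho> * (T ?f y - h y) = (T f\<^sub>1 y - ?g y) - (T f\<^sub>0 y - h\<^sub>0 y)"
        using \<rho> y by (simp add: right_diff_distrib)
      then have "\<bar>\<rho> * (T ?f y - h y)\<bar> \<le> \<rho> * \<eta>" using f1(3)[OF y] f0(3)[OF y] by linarith
      then have "\<rho> * \<bar>T ?f y - h y\<bar> \<le> \<rho> * \<eta>" using \<rho> by (simp add: abs_mult)
      then show ?thesis using \<rho> by simp
    qed
    ultimately show "\<exists>f\<in>BC X. (\<forall>x\<in>topspace X. \<bar>f x\<bar> \<le> 2 * real n / \<rho>) \<and>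
        (\<forall>y\<in>topspace Y. \<bar>T f y - h y\<bar> \<le> \<eta>)" by blast
  qed
qed

definition \<mu> :: "'b \<Rightarrow> 'a set \<Rightarrow> real" where
  "\<mu> y U = T (ind X U) y"

lemma charge_\<mu>: 
  assumes y: "y \<in> topspace Y" shows "charge (clopens X) (\<mu> y)"
  unfolding charge_def
proof (intro ballI impI)
  fix U V assume UV: "U \<in> clopens X" "V \<in> clopens X" and d: "disjnt U V"
  have "ind X (U \<union> V) = (\<lambda>x\<in>topspace X. ind X U x + ind X V x)"
    using d by (auto simp: fun_eq_iff ind_def indicator_def disjnt_iff)
  then show "\<mu> y (U \<union> V) = \<mu> y U + \<mu> y V"
    unfolding \<mu>_def using T_add[OF ind_in_BC[OF UV(1)] ind_in_BC[OF UV(2)] y] by simp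
qed

lemma continuous_\<mu>: "U \<in> clopens X \<Longrightarrow> continuous_map Y euclideanreal (\<lambda>y. \<mu> y U)"
  unfolding \<mu>_def using continuous_T[OF ind_in_BC] by simp

text \<open>Every non-null clopen set meets the finite set of \<open>T_local_bound\<close>, and disjoint sets meet it in different points.\<close>
lemma finite_support_\<mu>:
  assumes y: "y \<in> topspace Y"
  shows "\<exists>N. \<forall>E. charged_family (clopens X) (\<mu> y) E \<longrightarrow> card E \<le> N"
proof -
  obtain S c where S: "finite S" "S \<subseteq> topspace X" "c > 0" and
    bound: "\<And>f r. \<lbrakk>f \<in> BC X; r > 0; \<And>x. x \<in> S \<Longrightarrow> \<bar>f x\<bar> \<le> r\<rbrakk> \<Longrightarrow> \<bar>T f y\<bar> \<le> c * r"
    using T_local_bound[OF y] by metis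
  have meets: "\<exists>x\<in>S. x \<in> U" if U: "U \<in> clopens X" "\<mu> y U \<noteq> 0" for U
  proof (rule ccontr)
    assume no: "\<not> (\<exists>x\<in>S. x \<in> U)"
    have "\<bar>\<mu> y U\<bar> \<le> 0 + e" if "e > 0" for e
    proof -
      have "\<bar>T (ind X U) y\<bar> \<le> c * (e / c)"
        using no S that by (intro bound ind_in_BC U) (auto simp: ind_def indicator_def)
      then show ?thesis using S by (simp add: \<mu>_def)
    qed
    then have "\<bar>\<mu> y U\<bar> \<le> 0" by (rule field_le_epsilon)
    with U(2) show False by simp
  qed
  have "card E \<le> card S" if E: "charged_family (clopens X) (\<mu> y) E" for E
  proof -
    have "\<forall>U\<in>E. \<exists>x. x \<in> S \<and> x \<in> U" using meets E unfolding charged_family_def by blast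
    then obtain p where p: "\<And>U. U \<in> E \<Longrightarrow> p U \<in> S \<and> p U \<in> U" by metis
    have "inj_on p E"
    proof (rule inj_onI)
      fix U V assume UV: "U \<in> E" "V \<in> E" "p U = p V"
      then have "\<not> disjnt U V" using p[OF UV(1)] p[OF UV(2)] by (auto simp: disjnt_iff)
      then show "U = V" using E UV unfolding charged_family_def pairwise_def by blast
    qed
    then show ?thesis using p S(1) by (intro card_inj_on_le[of p]) auto
  qed
  then show ?thesis by blast
qed

lemma approximation_by_simple:
  assumes dim: "covering_dim_le X 0"
  shows "\<exists>K. \<forall>h\<in>BC Y. (\<forall>y\<in>topspace Y. \<bar>h y\<bar> \<le> 1) \<longrightarrow>
       (\<exists>\<P> c. finite_partition_in (topspace X) (clopens X) \<P> \<and> (\<forall>P\<in>\<P>. \<bar>c P\<bar> \<le> K) \<and>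
         (\<forall>y\<in>topspace Y. \<bar>(\<Sum>P\<in>\<P>. c P * \<mu> y P) - h y\<bar> \<le> 1/10))"
proof -
  obtain M where M: "M > 0" and bound: "\<And>f r y. \<lbrakk>f \<in> BC X; r > 0;
      \<And>x. x \<in> topspace X \<Longrightarrow> \<bar>f x\<bar> \<le> r; y \<in> topspace Y\<rbrakk> \<Longrightarrow> \<bar>T f y\<bar> \<le> M * r"
    using T_bounded by metis
  obtain K where K: "\<And>h. \<lbrakk>h \<in> BC Y; \<And>y. y \<in> topspace Y \<Longrightarrow> \<bar>h y\<bar> \<le> 1\<rbrakk> \<Longrightarrow>
       \<exists>f\<in>BC X. (\<forall>x\<in>topspace X. \<bar>f x\<bar> \<le> K) \<and> (\<forall>y\<in>topspace Y. \<bar>T f y - h y\<bar> \<le> 1/20)"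
    using T_almost_open[of "1/20"] by (metis zero_less_divide_1_iff zero_less_numeral)
  show ?thesis
  proof (rule exI[of _ K], intro ballI impI)
    fix h assume h: "h \<in> BC Y" and "\<forall>y\<in>topspace Y. \<bar>h y\<bar> \<le> 1"
    then have h1: "\<And>y. y \<in> topspace Y \<Longrightarrow> \<bar>h y\<bar> \<le> 1" by blast
    obtain f where f: "f \<in> BC X" and fK: "\<And>x. x \<in> topspace X \<Longrightarrow> \<bar>f x\<bar> \<le> K"
      and fh: "\<And>y. y \<in> topspace Y \<Longrightarrow> \<bar>T f y - h y\<bar> \<le> 1/20"
      using K[OF h h1] by blast
    have \<eta>: "1 / (20 * M) > 0" using M by simp
    obtain \<P> c where \<P>: "finite_partition_in (topspace X) (clopens X) \<P>"
      and c: "\<And>P. P \<in> \<P> \<Longrightarrow> \<bar>c P\<bar> \<le> K"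
      and near: "\<And>P x. \<lbrakk>P \<in> \<P>; x \<in> P\<rbrakk> \<Longrightarrow> \<bar>f x - c P\<bar> \<le> 1 / (20 * M)"
      using simple_approximation[OF dim f fK \<eta>] by blast
    have fin: "finite \<P>" "\<P> \<subseteq> clopens X" "disjoint \<P>" "\<Union>\<P> = topspace X"
      using \<P> unfolding finite_partition_in_def by auto
    let ?s = "\<lambda>x\<in>topspace X. \<Sum>P\<in>\<P>. c P * ind X P x"
    have s: "?s \<in> BC X" and Ts: "\<And>y. y \<in> topspace Y \<Longrightarrow> T ?s y = (\<Sum>P\<in>\<P>. c P * \<mu> y P)"
      using T_sum[OF fin(1), of "ind X" c] fin(2) ind_in_BC unfolding \<mu>_def by blast+
    have sval: "(\<Sum>Q\<in>\<P>. c Q * ind X Q x) = c P" if "P \<in> \<P>" "x \<in> P" for P x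
    proof -
      have x: "x \<in> topspace X" using that fin(4) by blast
      have "ind X Q x = 0" if "Q \<in> \<P> - {P}" for Q
      proof -
        have "disjnt P Q" using fin(3) \<open>P \<in> \<P>\<close> that unfolding pairwise_def by auto
        then show ?thesis using \<open>x \<in> P\<close> x by (auto simp: ind_def indicator_def disjnt_iff)
      qed
      then have "(\<Sum>Q\<in>\<P>. c Q * ind X Q x) = c P * ind X P x"
        using fin(1) that(1) by (subst sum.remove[of _ P]) auto
      then show ?thesis using x that(2) by (simp add: ind_def)
    qed
    have "\<bar>(\<Sum>P\<in>\<P>. c P * \<mu> y P) - h y\<bar> \<le> 1/10" if y: "y \<in> topspace Y" for y
    proof -
      have "\<bar>T (\<lambda>x\<in>topspace X. f x - ?s x) y\<bar> \<le> M * (1 / (20 * M))"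
      proof (rule bound[OF BC_diff[OF f s] \<eta> _ y])
        fix x assume x: "x \<in> topspace X"
        then obtain P where "P \<in> \<P>" "x \<in> P" using fin(4) by blast
        then show "\<bar>(\<lambda>x\<in>topspace X. f x - ?s x) x\<bar> \<le> 1 / (20 * M)"
          using near sval x by simp
      qed
      then have "\<bar>T f y - T ?s y\<bar> \<le> 1/20" using T_diff[OF f s y] M by simp
      then show ?thesis using fh[OF y] Ts[OF y] by linarith
    qed
    then show "\<exists>\<P> c. finite_partition_in (topspace X) (clopens X) \<P> \<and> (\<forall>P\<in>\<P>. \<bar>c P\<bar> \<le> K) \<and>
         (\<forall>y\<in>topspace Y. \<bar>(\<Sum>P\<in>\<P>. c P * \<mu> y P) - h y\<bar> \<le> 1/10)"
      using \<P> c by blast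
  qed
qed

end

section \<open>Separation by clopen sets\<close>

context Cp_star_surjection
begin

text \<open>In the topology induced by the charges, these functions separate a point near \<open>q\<close> from the complement of a basic
  neighbourhood. For rational \<open>q\<close> there are only countably many of them over a countable algebra.\<close>
definition bump :: "'a set set \<Rightarrow> ('a set \<Rightarrow> real) \<Rightarrow> nat \<Rightarrow> 'b \<Rightarrow> real" where
  "bump F q m = (\<lambda>y\<in>topspace Y. min 1 (real m * (\<Sum>U\<in>F. \<bar>\<mu> y U - q U\<bar>)))"

lemma bump_in_BC:
  assumes "finite F" "F \<subseteq> clopens X"
  shows "bump F q m \<in> BC Y" "y \<in> topspace Y \<Longrightarrow> \<bar>bump F q m y\<bar> \<le> 1"
proof -
  have range: "\<bar>min 1 (real m * (\<Sum>U\<in>F. \<bar>\<mu> y U - q U\<bar>))\<bar> \<le> 1" for y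
  proof -
    have "0 \<le> real m * (\<Sum>U\<in>F. \<bar>\<mu> y U - q U\<bar>)" by (intro mult_nonneg_nonneg sum_nonneg) auto
    then show ?thesis by simp
  qed
  have "continuous_map Y euclideanreal (\<lambda>y. \<mu> y U - q U)" if "U \<in> F" for U
    using continuous_\<mu> that assms(2) by (intro continuous_map_diff) auto
  then have "continuous_map Y euclideanreal (\<lambda>y. min 1 (real m * (\<Sum>U\<in>F. \<bar>\<mu> y U - q U\<bar>)))"
    using assms by (intro continuous_map_real_min continuous_map_real_mult_left continuous_map_sum
        continuous_map_real_abs) auto
  then show "bump F q m \<in> BC Y" unfolding bump_def by (rule BC_restrictI) (rule range)
  show "\<bar>bump F q m y\<bar> \<le> 1" if "y \<in> topspace Y"
    using range that by (simp add: bump_def)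
qed

text \<open>The algebra \<open>\<U>\<close> contains a partition along which \<open>g\<close> is approximated, and is closed under the
  Boolean operations and under the choice of such a partition for every rational bump function over \<open>\<U>\<close>.
  Thus \<open>g\<close> is, up to \<open>1/10\<close>, a continuous function on the space \<open>S\<close> of restricted charges, and the bump functions
  provide the uniform separation there.\<close>
theorem values_0_1_separated_by_clopen:
  assumes dim: "covering_dim_le X 0" and g: "continuous_map Y euclideanreal g"
    and g01: "\<And>y. y \<in> topspace Y \<Longrightarrow> 0 \<le> g y \<and> g y \<le> 1"
  shows "\<exists>C\<in>clopens Y. \<forall>y\<in>topspace Y. (g y = 0 \<longrightarrow> y \<notin> C) \<and> (g y = 1 \<longrightarrow> y \<in> C)"
proof -
  let ?\<Omega> = "topspace X"
  interpret clopens: algebra ?\<Omega> "clopens X" by (rule algebra_clopens)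
  define approx where "approx K h \<P> c \<longleftrightarrow> finite_partition_in ?\<Omega> (clopens X) \<P> \<and> (\<forall>P\<in>\<P>. \<bar>c P\<bar> \<le> K) \<and>
         (\<forall>y\<in>topspace Y. \<bar>(\<Sum>P\<in>\<P>. c P * \<mu> y P) - h y\<bar> \<le> 1/10)" for K :: real and h \<P> c
  obtain K where K: "\<And>h. \<lbrakk>h \<in> BC Y; \<And>y. y \<in> topspace Y \<Longrightarrow> \<bar>h y\<bar> \<le> 1\<rbrakk> \<Longrightarrow> \<exists>\<P> c. approx K h \<P> c"
    using approximation_by_simple[OF dim] unfolding approx_def[symmetric] by blast
  define part where "part h = (SOME \<P>. \<exists>c. approx K h \<P> c)" for h
  have part: "\<exists>c. approx K h (part h) c" if "h \<in> BC Y" "\<And>y. y \<in> topspace Y \<Longrightarrow> \<bar>h y\<bar> \<le> 1" for h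
    unfolding part_def by (rule someI_ex[OF K[OF that]])
  define coef where "coef h = (SOME c. approx K h (part h) c)" for h
  have coef: "approx K h (part h) (coef h)" if "h \<in> BC Y" "\<And>y. y \<in> topspace Y \<Longrightarrow> \<bar>h y\<bar> \<le> 1" for h
    unfolding coef_def by (rule someI_ex[OF part[OF that]])
  have part_sub: "countable (part h) \<and> part h \<subseteq> clopens X"
    if "h \<in> BC Y" "\<And>y. y \<in> topspace Y \<Longrightarrow> \<bar>h y\<bar> \<le> 1" for h
    using coef[OF that] unfolding approx_def finite_partition_in_def by (auto intro: countable_finite)
  define g' where "g' = restrict g (topspace Y)"
  have gBC: "g' \<in> BC Y" unfolding g'_def by (rule BC_restrictI[OF g, of 1]) (use g01 in force)
  have g1: "\<bar>g' y\<bar> \<le> 1" if "y \<in> topspace Y" for y using g01[OF that] that by (simp add: g'_def)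
  define \<Phi> where "\<Phi> F = (\<lambda>a. ?\<Omega> - a) ` F \<union> (\<lambda>(a, b). a \<inter> b) ` (F \<times> F) \<union>
      (\<Union>(q, m)\<in>(F \<rightarrow>\<^sub>E \<rat>) \<times> (UNIV :: nat set). part (bump F q m))" for F
  have \<Phi>: "countable (\<Phi> F) \<and> \<Phi> F \<subseteq> clopens X" if F: "finite F" "F \<subseteq> clopens X" for F
  proof
    have "countable ((F \<rightarrow>\<^sub>E \<rat>) \<times> (UNIV :: nat set))"
      using F(1) by (intro countable_SIGMA countable_PiE countable_rat) auto
    moreover have "countable (part (bump F q m))" "part (bump F q m) \<subseteq> clopens X" for q m
      using part_sub[OF bump_in_BC(1)[OF F] bump_in_BC(2)[OF F]] by blast+
    ultimately show "countable (\<Phi> F)"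
      unfolding \<Phi>_def using F(1) by (intro countable_Un countable_UN) (auto simp: countable_finite)
    show "\<Phi> F \<subseteq> clopens X"
      unfolding \<Phi>_def
    proof (intro Un_least image_subsetI UN_least)
      show "?\<Omega> - a \<in> clopens X" if "a \<in> F" for a using that F(2) by blast
      show "(\<lambda>(a, b). a \<inter> b) p \<in> clopens X" if "p \<in> F \<times> F" for p
        using that F(2) by auto
      show "(\<lambda>(q, m). part (bump F q m)) p \<subseteq> clopens X" for p
        using \<open>\<And>q m. part (bump F q m) \<subseteq> clopens X\<close> by (simp add: split_beta)
    qed
  qed
  have A0: "countable (insert {} (part g'))" "insert {} (part g') \<subseteq> clopens X"
    using part_sub[OF gBC g1] by auto
  obtain \<U> where cU: "countable \<U>" and U0: "insert {} (part g') \<subseteq> \<U>" and UC: "\<U> \<subseteq> clopens X"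
    and closed: "\<And>F. \<lbrakk>finite F; F \<subseteq> \<U>\<rbrakk> \<Longrightarrow> \<Phi> F \<subseteq> \<U>"
    using countable_closure_exists[of "insert {} (part g')" "clopens X" \<Phi>, OF A0 \<Phi>] by metis
  have alg: "algebra ?\<Omega> \<U>"
    unfolding algebra_iff_Int
  proof (intro conjI ballI)
    show "\<U> \<subseteq> Pow ?\<Omega>" using UC clopens.space_closed by blast
    show "{} \<in> \<U>" using U0 by blast
    fix a assume a: "a \<in> \<U>"
    have "?\<Omega> - a \<in> \<Phi> {a}" by (simp add: \<Phi>_def)
    then show "?\<Omega> - a \<in> \<U>" using closed[of "{a}"] a by blast
    fix b assume b: "b \<in> \<U>"
    have "a \<inter> b \<in> \<Phi> {a, b}" by (simp add: \<Phi>_def)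
    then show "a \<inter> b \<in> \<U>" using closed[of "{a, b}"] a b by blast
  qed
  interpret \<U>: algebra ?\<Omega> \<U> by (rule alg)
  have approxU: "finite_partition_in ?\<Omega> \<U> (part h) \<and> (\<forall>P\<in>part h. \<bar>coef h P\<bar> \<le> K) \<and>
      (\<forall>y\<in>topspace Y. \<bar>(\<Sum>P\<in>part h. coef h P * \<mu> y P) - h y\<bar> \<le> 1/10)"
    if "h \<in> BC Y" "\<And>y. y \<in> topspace Y \<Longrightarrow> \<bar>h y\<bar> \<le> 1" "part h \<subseteq> \<U>" for h
    using coef[OF that(1,2)] that(3) unfolding approx_def finite_partition_in_def by blast
  define \<kappa> where "\<kappa> y = restrict (\<mu> y) \<U>" for y
  define S where "S = \<kappa> ` topspace Y"
  let ?P = "product_topology (\<lambda>_. euclideanreal) \<U>"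
  interpret separating_charges ?\<Omega> \<U> S K
  proof
    show "countable \<U>" by (rule cU)
    show "S \<subseteq> extensional \<U>" by (auto simp: S_def \<kappa>_def)
    show "charge \<U> z" if "z \<in> S" for z
    proof -
      obtain y where y: "y \<in> topspace Y" "z = \<kappa> y" using \<open>z \<in> S\<close> unfolding S_def by blast
      have "\<mu> y (U \<union> V) = \<mu> y U + \<mu> y V" if "U \<in> \<U>" "V \<in> \<U>" "disjnt U V" for U V
        using charge_\<mu>[OF y(1)] that UC unfolding charge_def by blast
      then show ?thesis unfolding charge_def y(2) \<kappa>_def using \<U>.Un by simp
    qed
    show "\<exists>N. \<forall>E. charged_family \<U> z E \<longrightarrow> card E \<le> N" if "z \<in> S" for z
    proof -
      obtain y where y: "y \<in> topspace Y" "z = \<kappa> y" using \<open>z \<in> S\<close> unfolding S_def by blast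
      have "charged_family (clopens X) (\<mu> y) E" if "charged_family \<U> z E" for E
        using that UC unfolding charged_family_def y(2) \<kappa>_def by (auto simp: subset_iff)
      then show ?thesis using finite_support_\<mu>[OF y(1)] by blast
    qed
    fix A z\<^sub>0 assume A: "closedin (subtopology ?P S) A" and z0: "z\<^sub>0 \<in> S - A"
    obtain y\<^sub>0 where y0: "y\<^sub>0 \<in> topspace Y" "z\<^sub>0 = \<kappa> y\<^sub>0" using z0 unfolding S_def by blast
    obtain W where W: "closedin ?P W" "A = W \<inter> S" using A unfolding closedin_subtopology by blast
    have "z\<^sub>0 \<in> topspace ?P - W" using z0 W(2) y0(2) by (auto simp: \<kappa>_def)
    moreover have "openin ?P (topspace ?P - W)" using W(1) by blast
    ultimately have "\<exists>V. finite {U \<in> \<U>. V U \<noteq> topspace euclideanreal} \<and>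
        (\<forall>U\<in>\<U>. openin euclideanreal (V U)) \<and> z\<^sub>0 \<in> Pi\<^sub>E \<U> V \<and> Pi\<^sub>E \<U> V \<subseteq> topspace ?P - W"
      unfolding openin_product_topology_alt by (elim bspec[rotated])
    then obtain V where finV: "finite {U \<in> \<U>. V U \<noteq> UNIV}"
      and openV: "\<forall>U\<in>\<U>. openin euclideanreal (V U)" and V0: "z\<^sub>0 \<in> Pi\<^sub>E \<U> V"
      and VW: "Pi\<^sub>E \<U> V \<subseteq> topspace ?P - W"
      unfolding topspace_euclidean by (elim exE conjE) (rule that)
    define F where "F = {U \<in> \<U>. V U \<noteq> UNIV}"
    have F: "finite F" "F \<subseteq> \<U>" "F \<subseteq> clopens X" using finV UC by (auto simp: F_def)
    have "\<exists>e>0. \<forall>t. \<bar>t - \<mu> y\<^sub>0 U\<bar> < e \<longrightarrow> t \<in> V U" if U: "U \<in> F" for U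
    proof -
      have UU: "U \<in> \<U>" using U F by blast
      have "open (V U)" "\<mu> y\<^sub>0 U \<in> V U"
        using openV UU PiE_mem[OF V0 UU] by (auto simp: y0(2) \<kappa>_def)
      then obtain e where "e > 0" "ball (\<mu> y\<^sub>0 U) e \<subseteq> V U" by (meson openE)
      then show ?thesis
        by (intro exI[of _ e]) (auto simp: dist_real_def abs_minus_commute subset_iff)
    qed
    then obtain e where e: "\<And>U. U \<in> F \<Longrightarrow> e U > 0"
      "\<And>U t. \<lbrakk>U \<in> F; \<bar>t - \<mu> y\<^sub>0 U\<bar> < e U\<rbrakk> \<Longrightarrow> t \<in> V U" by metis
    define d where "d = Min (insert 1 (e ` F))"
    have d: "d > 0" using F(1) e(1) unfolding d_def by (subst Min_gr_iff) auto
    have de: "d \<le> e U" if "U \<in> F" for U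
      unfolding d_def using F(1) that by (intro Min_le) auto
    \<comment> \<open>The slope \<open>m\<close> is chosen such that a deviation by \<open>d\<close> in one coordinate saturates the bump.\<close>
    obtain m where m: "2 / d < real m" using reals_Archimedean2 by blast
    then have m0: "real m > 0" using d by (meson divide_pos_pos less_trans zero_less_numeral)
    define n where "n = real (card F) + 1"
    have n: "n > 0" by (simp add: n_def)
    \<comment> \<open>\<open>q\<close> approximates the centre so closely that the bump is at most \<open>1/10\<close> there, while \<open>m d > 2\<close> makes it
      \<open>1\<close> outside the neighbourhood.\<close>
    define t where "t = 1 / (10 * real m * n)"
    have t: "t > 0" using m0 n by (simp add: t_def)
    have "\<exists>q\<in>\<rat>. \<bar>\<mu> y\<^sub>0 U - q\<bar> < t" for U
    proof -
      obtain q where "q \<in> \<rat>" "\<mu> y\<^sub>0 U - t < q" "q < \<mu> y\<^sub>0 U + t"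
        using Rats_dense_in_real[of "\<mu> y\<^sub>0 U - t" "\<mu> y\<^sub>0 U + t"] t by auto
      then show ?thesis by (intro bexI[of _ q]) (auto simp: abs_less_iff)
    qed
    then obtain q' where q': "\<And>U. q' U \<in> \<rat>" "\<And>U. \<bar>\<mu> y\<^sub>0 U - q' U\<bar> < t" by metis
    define q where "q = restrict q' F"
    define h where "h = bump F q m"
    have h: "h \<in> BC Y" "\<And>y. y \<in> topspace Y \<Longrightarrow> \<bar>h y\<bar> \<le> 1"
      unfolding h_def by (rule bump_in_BC[OF F(1,3)], assumption?)+
    have "q \<in> F \<rightarrow>\<^sub>E \<rat>" using q'(1) by (auto simp: q_def)
    then have "part h \<subseteq> \<Phi> F" unfolding \<Phi>_def h_def by blast
    then have "part h \<subseteq> \<U>" using closed[OF F(1,2)] by blast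
    note app = approxU[OF h this]
    have tm: "real m * t * n = 1/10" using m0 n by (simp add: t_def)
    have h_y0: "h y\<^sub>0 \<le> 1/10"
    proof -
      have "(\<Sum>U\<in>F. \<bar>\<mu> y\<^sub>0 U - q U\<bar>) \<le> (\<Sum>U\<in>F. t)"
        using q'(2) by (intro sum_mono) (simp add: q_def less_imp_le)
      also have "\<dots> \<le> t * n" using t by (simp add: n_def algebra_simps)
      finally have "real m * (\<Sum>U\<in>F. \<bar>\<mu> y\<^sub>0 U - q U\<bar>) \<le> real m * (t * n)"
        using m0 by (intro mult_left_mono) auto
      then have "real m * (\<Sum>U\<in>F. \<bar>\<mu> y\<^sub>0 U - q U\<bar>) \<le> 1/10" using tm by (simp add: mult.assoc)
      moreover have "h y\<^sub>0 = min 1 (real m * (\<Sum>U\<in>F. \<bar>\<mu> y\<^sub>0 U - q U\<bar>))"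
        using y0(1) by (simp add: h_def bump_def)
      ultimately show ?thesis by linarith
    qed
    have h_A: "h y = 1" if y: "y \<in> topspace Y" "\<kappa> y \<in> A" for y
    proof -
      have "\<kappa> y \<notin> Pi\<^sub>E \<U> V" using VW y(2) W(2) by blast
      moreover have "\<kappa> y \<in> extensional \<U>" by (simp add: \<kappa>_def)
      ultimately obtain U where U: "U \<in> \<U>" "\<mu> y U \<notin> V U" by (auto simp: PiE_def Pi_def \<kappa>_def)
      then have UF: "U \<in> F" by (auto simp: F_def)
      have "\<not> \<bar>\<mu> y U - \<mu> y\<^sub>0 U\<bar> < e U" using e(2)[OF UF] U(2) by blast
      then have "\<bar>\<mu> y U - \<mu> y\<^sub>0 U\<bar> \<ge> d" using de[OF UF] by linarith
      moreover have "\<bar>\<mu> y\<^sub>0 U - q U\<bar> < t" using q'(2) UF by (simp add: q_def)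
      ultimately have "d - t \<le> \<bar>\<mu> y U - q U\<bar>" by linarith
      also have "\<dots> \<le> (\<Sum>U\<in>F. \<bar>\<mu> y U - q U\<bar>)" using F(1) UF by (intro member_le_sum) auto
      finally have "real m * (d - t) \<le> real m * (\<Sum>U\<in>F. \<bar>\<mu> y U - q U\<bar>)"
        using m0 by (intro mult_left_mono) auto
      moreover have "real m * (d - t) \<ge> 1"
      proof -
        have "2 < real m * d" using m d by (simp add: field_simps)
        moreover have "real m * t * 1 \<le> real m * t * n"
          using m0 t by (intro mult_left_mono) (auto simp: n_def)
        then have "real m * t \<le> 1/10" using tm by simp
        ultimately show ?thesis by (simp add: right_diff_distrib)
      qed
      ultimately show ?thesis using y(1) by (simp add: h_def bump_def)
    qed
    have "(\<Sum>P\<in>part h. coef h P * z\<^sub>0 P) + 1/2 \<le> (\<Sum>P\<in>part h. coef h P * z P)" if z: "z \<in> A" for z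
    proof -
      obtain y where y: "y \<in> topspace Y" "z = \<kappa> y" using z W(2) unfolding S_def by blast
      have sums: "(\<Sum>P\<in>part h. coef h P * \<kappa> y' P) = (\<Sum>P\<in>part h. coef h P * \<mu> y' P)" for y'
        using \<open>part h \<subseteq> \<U>\<close> by (intro sum.cong) (auto simp: \<kappa>_def)
      have "\<bar>(\<Sum>P\<in>part h. coef h P * z P) - 1\<bar> \<le> 1/10"
        using app y(1) h_A[OF y(1)] z unfolding y(2) sums by auto
      moreover have "\<bar>(\<Sum>P\<in>part h. coef h P * z\<^sub>0 P) - h y\<^sub>0\<bar> \<le> 1/10"
        using app y0(1) unfolding y0(2) sums by auto
      ultimately show ?thesis using h_y0 by linarith
    qed
    then show "\<exists>\<P> c. finite_partition_in ?\<Omega> \<U> \<P> \<and> (\<forall>P\<in>\<P>. \<bar>c P\<bar> \<le> K) \<and>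
         (\<forall>z\<in>A. (\<Sum>P\<in>\<P>. c P * z\<^sub>0 P) + 1/2 \<le> (\<Sum>P\<in>\<P>. c P * z P))"
      using app by blast
  qed
  have \<kappa>_cont: "continuous_map Y Z \<kappa>"
    unfolding Z_def continuous_map_in_subtopology continuous_map_componentwise
  proof (intro conjI ballI)
    show "\<kappa> \<in> topspace Y \<rightarrow> S" by (auto simp: S_def)
    show "\<kappa> ` topspace Y \<subseteq> extensional \<U>" by (auto simp: \<kappa>_def)
    fix U assume U: "U \<in> \<U>"
    then show "continuous_map Y euclideanreal (\<lambda>y. \<kappa> y U)"
      using continuous_\<mu> UC by (auto simp: \<kappa>_def)
  qed
  define G where "G z = (\<Sum>P\<in>part g'. coef g' P * z P)" for z
  have "part g' \<subseteq> \<U>" using U0 by blast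
  note app = approxU[OF gBC g1 this]
  have Gg: "\<bar>G (\<kappa> y) - g y\<bar> \<le> 1/10" if "y \<in> topspace Y" for y
  proof -
    have "G (\<kappa> y) = (\<Sum>P\<in>part g'. coef g' P * \<mu> y P)"
      unfolding G_def using \<open>part g' \<subseteq> \<U>\<close> by (intro sum.cong) (auto simp: \<kappa>_def)
    moreover have "\<bar>(\<Sum>P\<in>part g'. coef g' P * \<mu> y P) - g' y\<bar> \<le> 1/10" using app that by blast
    ultimately show ?thesis using that by (simp add: g'_def)
  qed
  have "finite (part g')" using app unfolding finite_partition_in_def by blast
  then have G_cont: "continuous_map Z euclideanreal G"
    unfolding G_def using \<open>part g' \<subseteq> \<U>\<close>
    by (intro continuous_map_sum continuous_map_real_mult_left continuous_map_eval) auto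
  define high where "high = {z \<in> topspace Z. G z \<in> {3/4..}}"
  define low where "low = {z \<in> topspace Z. G z \<in> {..1/4}}"
  have "closedin Z high" "closedin Z low"
    unfolding high_def low_def by (rule closedin_continuous_map_preimage[OF G_cont]; simp)+
  moreover have "disjnt high low" by (auto simp: high_def low_def disjnt_iff)
  ultimately obtain C where C: "closedin Z C" "openin Z C" "high \<subseteq> C" "disjnt low C"
    using large_zero_dim_Z unfolding large_zero_dim_def by blast
  let ?D = "{y \<in> topspace Y. \<kappa> y \<in> C}"
  have "?D \<in> clopens Y"
    unfolding clopens_def
    using closedin_continuous_map_preimage[OF \<kappa>_cont C(1)] openin_continuous_map_preimage[OF \<kappa>_cont C(2)]
    by blast
  moreover have "(g y = 0 \<longrightarrow> y \<notin> ?D) \<and> (g y = 1 \<longrightarrow> y \<in> ?D)" if y: "y \<in> topspace Y" for y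
  proof (intro conjI impI)
    have kZ: "\<kappa> y \<in> topspace Z" unfolding topspace_Z unfolding S_def using y by (rule imageI)
    show "y \<notin> ?D" if "g y = 0"
    proof -
      have "G (\<kappa> y) \<le> 1/4" using Gg[OF y] that by linarith
      then have "\<kappa> y \<in> low" using kZ by (simp add: low_def)
      then show ?thesis using C(4) by (auto simp: disjnt_iff)
    qed
    show "y \<in> ?D" if "g y = 1"
    proof -
      have "3/4 \<le> G (\<kappa> y)" using Gg[OF y] that by linarith
      then have "\<kappa> y \<in> high" using kZ by (simp add: high_def)
      then show ?thesis using C(3) y by blast
    qed
  qed
  ultimately show ?thesis by blast
qed

end

theorem corollary1p2:
  fixes X :: "'a topology" and Y :: "'b topology"
    and T :: "('a \<Rightarrow> real) \<Rightarrow> ('b \<Rightarrow> real)"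
  assumes "tychonoff_space X" and "topspace X \<noteq> {}"
    and "tychonoff_space Y" and "topspace Y \<noteq> {}"
    and "linear_Cp_star X Y T"
    and "continuous_map (Cp_star X) (Cp_star Y) T"
    and "T ` topspace (Cp_star X) = topspace (Cp_star Y)"
    and "covering_dim X = 0"
  shows "covering_dim Y = 0"
proof -
  interpret Cp_star_surjection X Y T
    by unfold_locales (fact assms)+
  have "covering_dim_le X 0"
    using assms(8) covering_dim_le_iff[of X 0] by (simp add: zero_enat_def)
  then have "covering_dim_le Y 0"
    using values_0_1_separated_by_clopen by (intro covering_dim_le_0_if_separated) blast
  then show ?thesis
    using covering_dim_le_iff[of Y 0] by (simp add: zero_enat_def[symmetric])
qed

end
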